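(* Let $\overline{\mathrm{Spec}\,\mathbb Z}=\mathrm{Spec}\,\mathbb Z\cup\{\infty\}$. (i) The assignment $U\mapsto \mathcal O_{\overline{\mathrm{Spec}\,\mathbb Z}}(U)$ given by $H\mathcal O_{\mathrm{Spec}\,\mathbb Z}(U)$ for $\infty\notin U$ and by $\Vert H\mathcal O_{\mathrm{Spec}\,\mathbb Z}(U\cap\mathrm{Spec}\,\mathbb Z)\Vert_1$ for $\infty\in U$, together with the inclusions $\mathcal O_{\overline{\mathrm{Spec}\,\mathbb Z}}(U)\subset H\mathbb Q$ and the restriction maps, defines a sheaf $\mathcal O_{\overline{\mathrm{Spec}\,\mathbb Z}}$ of $\mathbb S$-algebras over $\overline{\mathrm{Spec}\,\mathbb Z}$. (ii) Let $D=(D_{\rm fin},D_\infty)$ be an Arakelov divisor on $\overline{\mathrm{Spec}\,\mathbb Z}$, with $D_\infty=a\{\infty\}$. Then the formula $$\mathcal O(D)(U):=\Vert H\mathcal O(D_{\rm fin})(U\cap\mathrm{Spec}\,\mathbb Z)\Vert_{e^a}\qquad\text{for all open } U\ni\infty$$ defines a sheaf $\mathcal O(D)$ of $\mathcal O_{\overline{\mathrm{Spec}\,\mathbb Z}}$-modules over $\overline{\mathrm{Spec}\,\mathbb Z}$ extending the sheaf $\mathcal O(D_{\rm fin})$ on $\mathrm{Spec}\,\mathbb Z$ (that is, $\mathcal O(D)(U)=H\mathcal O(D_{\rm fin})(U)$ for $\infty\notin U$).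
   Context: $\mathbb S$-algebras: let $k_+=\{0,\dots,k\}$ pointed by $0$ and $\Gamma^{\rm op}$ the full subcategory of finite pointed sets on the objects $k_+$ (functors are evaluated on all finite pointed sets via the evident equivalence). A $\Gamma$-set is a functor $\Gamma^{\rm op}\to\mathrm{Sets}_*$ sending $0_+$ to a point. Their smash product is the Day convolution: morphisms $F_1\wedge F_2\to G$ are families of pointed maps $F_1(X)\wedge F_2(Y)\to G(X\wedge Y)$ natural in $X,Y$; the unit is the inclusion functor $\mathbb S$. An $\mathbb S$-algebra is a monoid in $(\Gamma\text{-sets},\wedge,\mathbb S)$ and a module over it is a module over this monoid. For a semiring $R$, $HR$ is the $\mathbb S$-algebra $HR(X)=R^{X\setminus\{*\}}$ with $HR(f)(\phi)(y)=\sum_{x\in f^{-1}(y)}\phi(x)$ for $y\neq *$, product $(\phi\psi)(x,y)=\phi(x)\psi(y)$ and unit $x\mapsto\delta_x$. For an $R$-module $E$, $HE$ is defined by the same formulas and is an $HR$-module. For a subring $R\subset\mathbb Q$ and an $R$-submodule $E\subset\mathbb Q$, with the usual absolute value $|\cdot|$, and $\lambda>0$, $$\Vert HR\Vert_1(X)=\{\phi\in HR(X):\textstyle\sum_{x\ne *}|\phi(x)|\le 1\},\qquad \Vert HE\Vert_\lambda(X)=\{\phi\in HE(X):\textstyle\sum_{x\ne *}|\phi(x)|\le\lambda\}.$$ Topology: the non-empty open sets of $\overline{\mathrm{Spec}\,\mathbb Z}$ are the complements of finite sets $F$ of (non-generic) points, i.e. finite sets of primes with possibly $\infty\in F$; $\mathrm{Spec}\,\mathbb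 Z$ carries the Zariski topology. The sheaf $\mathcal O_{\mathrm{Spec}\,\mathbb Z}$ is viewed as a subsheaf of the constant sheaf $\mathbb Q$: on the complement of a finite set $F$ of primes it is the ring of fractions with denominators involving only primes in $F$. On non-empty open sets all structures are viewed inside $H\mathbb Q$ and restriction maps are inclusions; on the empty set the value is the one-point $\Gamma$-set. An Arakelov divisor is a pair $D=(D_{\rm fin},D_\infty)$ with $D_{\rm fin}=\sum_p n_p\{p\}$ a divisor on $\mathrm{Spec}\,\mathbb Z$ (finitely many nonzero $n_p\in\mathbb Z$) and $D_\infty=a\{\infty\}$, $a\in\mathbb R$. $\mathcal O(D_{\rm fin})$ is the usual sheaf of $\mathcal O_{\mathrm{Spec}\,\mathbb Z}$-modules, viewed as a subsheaf of the constant sheaf $\mathbb Q$: for non-empty open $V\subset\mathrm{Spec}\,\mathbb Z$, $\mathcal O(D_{\rm fin})(V)=\{q\in\mathbb Q: q=0 \text{ or } v_p(q)+n_p\ge0\ \forall p\in V\}$. *)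

theory Defs
  imports
    "HOL-Library.FuncSet"
    "HOL-Computational_Algebra.Primes"
    "HOL-Analysis.Abstract_Topology"
begin

section \<open>The category of finite pointed sets and its smash product\<close>

text \<open>
  The object \<open>k\<^sub>+\<close> is the set \<open>{..k}\<close> pointed by \<open>0\<close>, represented by the number \<open>k\<close>; morphisms are
  extensional functions.  The lexicographic bijection
  \<open>(i, j) \<mapsto> (i - 1) * l + j\<close> identifies \<open>k\<^sub>+ \<and> l\<^sub>+\<close> with \<open>(k * l)\<^sub>+\<close>.  With this
  choice the smash product is strictly associative and \<open>1\<^sub>+\<close> is a strict unit, see
  \<open>smash_pt_assoc\<close> and \<open>smash_pt_unit\<close>, so that no associativity or unit isomorphisms appear below.
\<close>

definition pointed_maps :: "nat \<Rightarrow> nat \<Rightarrow> (nat \<Rightarrow> nat) set" where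
  "pointed_maps k l = {f \<in> {..k} \<rightarrow>\<^sub>E {..l}. f 0 = 0}"

definition smash_pt :: "nat \<Rightarrow> nat \<Rightarrow> nat \<Rightarrow> nat" where
  "smash_pt l i j = (if i = 0 \<or> j = 0 then 0 else (i - 1) * l + j)"

definition smash_fst :: "nat \<Rightarrow> nat \<Rightarrow> nat" where
  "smash_fst l n = (n - 1) div l + 1"

definition smash_snd :: "nat \<Rightarrow> nat \<Rightarrow> nat" where
  "smash_snd l n = (n - 1) mod l + 1"

text \<open>The map \<open>f \<and> g : k\<^sub>+ \<and> l\<^sub>+ \<rightarrow> k'\<^sub>+ \<and> l'\<^sub>+\<close> induced by \<open>f : k\<^sub>+ \<rightarrow> k'\<^sub>+\<close> and \<open>g : l\<^sub>+ \<rightarrow> l'\<^sub>+\<close>.\<close>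

definition smash_map :: "nat \<Rightarrow> nat \<Rightarrow> nat \<Rightarrow> (nat \<Rightarrow> nat) \<Rightarrow> (nat \<Rightarrow> nat) \<Rightarrow> nat \<Rightarrow> nat" where
  "smash_map k l l' f g =
     (\<lambda>n\<in>{..k * l}. if n = 0 then 0 else smash_pt l' (f (smash_fst l n)) (g (smash_snd l n)))"

lemma smash_fst_pt: "1 \<le> i \<Longrightarrow> 1 \<le> j \<Longrightarrow> j \<le> l \<Longrightarrow> smash_fst l (smash_pt l i j) = i"
  and smash_snd_pt: "1 \<le> i \<Longrightarrow> 1 \<le> j \<Longrightarrow> j \<le> l \<Longrightarrow> smash_snd l (smash_pt l i j) = j"
proof -
  assume a: "1 \<le> i" "1 \<le> j" "j \<le> l"
  have e: "smash_pt l i j - 1 = (j - 1) + (i - 1) * l" using a by (simp add: smash_pt_def)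
  have l: "l \<noteq> 0" "j - 1 < l" using a by auto
  have "(smash_pt l i j - 1) div l = i - 1" "(smash_pt l i j - 1) mod l = j - 1"
    unfolding e div_mult_self1[OF l(1)] mod_mult_self1 using l(2) by auto
  then show "smash_fst l (smash_pt l i j) = i" "smash_snd l (smash_pt l i j) = j"
    using a by (simp_all add: smash_fst_def smash_snd_def)
qed

lemma smash_pt_fst_snd:
  assumes "n \<in> {1..k * l}"
  shows "smash_fst l n \<in> {1..k}" "smash_snd l n \<in> {1..l}"
    "smash_pt l (smash_fst l n) (smash_snd l n) = n"
proof -
  have l: "l > 0" using assms by (cases l) auto
  have "n - 1 < k * l" using assms by auto
  then have "(n - 1) div l < k" by (simp add: less_mult_imp_div_less)
  then show "smash_fst l n \<in> {1..k}" by (auto simp: smash_fst_def)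
  show "smash_snd l n \<in> {1..l}" using l by (auto simp: smash_snd_def Suc_leI)
  have "(n - 1) div l * l + (n - 1) mod l = n - 1" by (rule div_mult_mod_eq)
  then show "smash_pt l (smash_fst l n) (smash_snd l n) = n"
    using assms by (simp add: smash_pt_def smash_fst_def smash_snd_def)
qed

lemma smash_pt_bij: "bij_betw (\<lambda>(i, j). smash_pt l i j) ({1..k} \<times> {1..l}) {1..k * l}"
proof (rule bij_betw_byWitness[where f' = "\<lambda>n. (smash_fst l n, smash_snd l n)"])
  show "\<forall>a\<in>{1..k} \<times> {1..l}. (smash_fst l (case a of (i, j) \<Rightarrow> smash_pt l i j),
          smash_snd l (case a of (i, j) \<Rightarrow> smash_pt l i j)) = a"
    by (auto simp: smash_fst_pt smash_snd_pt)
  show "\<forall>n\<in>{1..k * l}. (case (smash_fst l n, smash_snd l n) of (i, j) \<Rightarrow> smash_pt l i j) = n"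
    using smash_pt_fst_snd(3) by auto
  show "(\<lambda>(i, j). smash_pt l i j) ` ({1..k} \<times> {1..l}) \<subseteq> {1..k * l}"
  proof clarify
    fix i j assume a: "i \<in> {1..k}" "j \<in> {1..l}"
    then have "(i - 1) * l + j \<le> (k - 1) * l + l" by (intro add_mono mult_right_mono) auto
    also have "\<dots> = k * l" using a by (cases k) auto
    finally show "smash_pt l i j \<in> {1..k * l}" using a by (auto simp: smash_pt_def)
  qed
  show "(\<lambda>n. (smash_fst l n, smash_snd l n)) ` {1..k * l} \<subseteq> {1..k} \<times> {1..l}"
    using smash_pt_fst_snd(1,2) by blast
qed

lemma smash_pt_assoc:
  "smash_pt m (smash_pt l h i) j = smash_pt (l * m) h (smash_pt m i j)"
proof (cases "h = 0 \<or> i = 0 \<or> j = 0")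
  case True
  then show ?thesis by (auto simp: smash_pt_def)
next
  case False
  then obtain h' i' where "h = Suc h'" "i = Suc i'" by (metis not0_implies_Suc)
  with False show ?thesis by (simp add: smash_pt_def algebra_simps)
qed

lemma smash_pt_unit: "smash_pt l 1 j = j" "smash_pt 1 i 1 = i"
  by (auto simp: smash_pt_def)

lemma smash_map_pt:
  assumes "f \<in> pointed_maps k k'" "g \<in> pointed_maps l l'" "i \<le> k" "j \<le> l"
  shows "smash_map k l l' f g (smash_pt l i j) = smash_pt l' (f i) (g j)"
proof (cases "i = 0 \<or> j = 0")
  case True
  then show ?thesis using assms(1,2) by (auto simp: smash_map_def smash_pt_def pointed_maps_def)
next
  case False
  then have ij: "i \<in> {1..k}" "j \<in> {1..l}" using assms by auto
  then have "smash_pt l i j \<in> {1..k * l}"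
    using smash_pt_bij[of l k] unfolding bij_betw_def by (metis SigmaI case_prod_conv image_eqI)
  then show ?thesis using ij by (auto simp: smash_map_def smash_fst_pt smash_snd_pt)
qed


section \<open>\<open>\<Gamma>\<close>-sets, \<open>\<S>\<close>-algebras and modules\<close>

record 'a gamma_set =
  gob :: "nat \<Rightarrow> 'a set"
  gbase :: "nat \<Rightarrow> 'a"
  gmap :: "nat \<Rightarrow> nat \<Rightarrow> (nat \<Rightarrow> nat) \<Rightarrow> 'a \<Rightarrow> 'a"

locale gamma_set =
  fixes F :: "('a, 'x) gamma_set_scheme"
  assumes base: "gbase F k \<in> gob F k"
    and zero: "gob F 0 = {gbase F 0}"
    and map_closed: "f \<in> pointed_maps k l \<Longrightarrow> x \<in> gob F k \<Longrightarrow> gmap F k l f x \<in> gob F l"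
    and map_base: "f \<in> pointed_maps k l \<Longrightarrow> gmap F k l f (gbase F k) = gbase F l"
    and map_id: "x \<in> gob F k \<Longrightarrow> gmap F k k (\<lambda>i\<in>{..k}. i) x = x"
    and map_comp: "f \<in> pointed_maps k l \<Longrightarrow> g \<in> pointed_maps l m \<Longrightarrow> x \<in> gob F k \<Longrightarrow>
      gmap F k m (compose {..k} g f) x = gmap F l m g (gmap F k l f x)"

text \<open>The unit object: the inclusion functor.\<close>

definition sphere :: "nat gamma_set" where
  "sphere = \<lparr>gob = (\<lambda>k. {..k}), gbase = (\<lambda>k. 0), gmap = (\<lambda>k l f. f)\<rparr>"

definition gamma_morphism ::
  "('a, 'x) gamma_set_scheme \<Rightarrow> ('b, 'y) gamma_set_scheme \<Rightarrow> (nat \<Rightarrow> 'a \<Rightarrow> 'b) \<Rightarrow> bool" where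
  "gamma_morphism F G t \<longleftrightarrow>
     (\<forall>k. \<forall>x\<in>gob F k. t k x \<in> gob G k) \<and>
     (\<forall>k. t k (gbase F k) = gbase G k) \<and>
     (\<forall>k l. \<forall>f\<in>pointed_maps k l. \<forall>x\<in>gob F k. t l (gmap F k l f x) = gmap G k l f (t k x))"

text \<open>
  A morphism \<open>F\<^sub>1 \<and> F\<^sub>2 \<rightarrow> G\<close> out of the Day convolution, given by its natural
  family of pointed maps \<open>F\<^sub>1(k\<^sub>+) \<and> F\<^sub>2(l\<^sub>+) \<rightarrow> G(k\<^sub>+ \<and> l\<^sub>+)\<close>.
\<close>

definition day_morphism ::
  "('a, 'x) gamma_set_scheme \<Rightarrow> ('b, 'y) gamma_set_scheme \<Rightarrow> ('c, 'z) gamma_set_scheme \<Rightarrow>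
   (nat \<Rightarrow> nat \<Rightarrow> 'a \<Rightarrow> 'b \<Rightarrow> 'c) \<Rightarrow> bool" where
  "day_morphism F\<^sub>1 F\<^sub>2 G \<mu> \<longleftrightarrow>
     (\<forall>k l. \<forall>x\<in>gob F\<^sub>1 k. \<forall>y\<in>gob F\<^sub>2 l. \<mu> k l x y \<in> gob G (k * l)) \<and>
     (\<forall>k l. \<forall>y\<in>gob F\<^sub>2 l. \<mu> k l (gbase F\<^sub>1 k) y = gbase G (k * l)) \<and>
     (\<forall>k l. \<forall>x\<in>gob F\<^sub>1 k. \<mu> k l x (gbase F\<^sub>2 l) = gbase G (k * l)) \<and>
     (\<forall>k l k' l'. \<forall>f\<in>pointed_maps k k'. \<forall>g\<in>pointed_maps l l'. \<forall>x\<in>gob F\<^sub>1 k. \<forall>y\<in>gob F\<^sub>2 l.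
        gmap G (k * l) (k' * l') (smash_map k l l' f g) (\<mu> k l x y)
          = \<mu> k' l' (gmap F\<^sub>1 k k' f x) (gmap F\<^sub>2 l l' g y))"

record 'a s_algebra = "'a gamma_set" +
  sunit :: "nat \<Rightarrow> nat \<Rightarrow> 'a"
  smult :: "nat \<Rightarrow> nat \<Rightarrow> 'a \<Rightarrow> 'a \<Rightarrow> 'a"

text \<open>
  The unit axioms compare \<open>\<S> \<and> A \<rightarrow> A \<and> A \<rightarrow> A\<close> with the canonical isomorphism
  \<open>\<S> \<and> A \<cong> A\<close>, which is the family \<open>(i, x) \<mapsto> A(j \<mapsto> i \<and> j)(x)\<close>, and similarly on the right.
\<close>

locale s_algebra = gamma_set A for A :: "('a, 'x) s_algebra_scheme" +
  assumes unit_morphism: "gamma_morphism sphere A (sunit A)"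
    and mult_morphism: "day_morphism A A A (smult A)"
    and mult_assoc: "x \<in> gob A k \<Longrightarrow> y \<in> gob A l \<Longrightarrow> z \<in> gob A m \<Longrightarrow>
      smult A (k * l) m (smult A k l x y) z = smult A k (l * m) x (smult A l m y z)"
    and unit_left: "i \<le> k \<Longrightarrow> x \<in> gob A l \<Longrightarrow>
      smult A k l (sunit A k i) x = gmap A l (k * l) (\<lambda>j\<in>{..l}. smash_pt l i j) x"
    and unit_right: "i \<le> k \<Longrightarrow> x \<in> gob A l \<Longrightarrow>
      smult A l k x (sunit A k i) = gmap A l (l * k) (\<lambda>j\<in>{..l}. smash_pt k j i) x"

definition s_algebra_morphism ::
  "('a, 'x) s_algebra_scheme \<Rightarrow> ('b, 'y) s_algebra_scheme \<Rightarrow> (nat \<Rightarrow> 'a \<Rightarrow> 'b) \<Rightarrow> bool" where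
  "s_algebra_morphism A B t \<longleftrightarrow>
     gamma_morphism A B t \<and>
     (\<forall>k. \<forall>i\<le>k. t k (sunit A k i) = sunit B k i) \<and>
     (\<forall>k l. \<forall>x\<in>gob A k. \<forall>y\<in>gob A l. t (k * l) (smult A k l x y) = smult B k l (t k x) (t l y))"

record ('a, 'm) s_module = "'m gamma_set" +
  sact :: "nat \<Rightarrow> nat \<Rightarrow> 'a \<Rightarrow> 'm \<Rightarrow> 'm"

locale s_module = A: s_algebra A + M: gamma_set M
  for A :: "('a, 'x) s_algebra_scheme" and M :: "('a, 'm, 'y) s_module_scheme" +
  assumes act_morphism: "day_morphism A M M (sact M)"
    and act_assoc: "x \<in> gob A k \<Longrightarrow> y \<in> gob A l \<Longrightarrow> m \<in> gob M n \<Longrightarrow>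
      sact M (k * l) n (smult A k l x y) m = sact M k (l * n) x (sact M l n y m)"
    and act_unit: "i \<le> k \<Longrightarrow> m \<in> gob M l \<Longrightarrow>
      sact M k l (sunit A k i) m = gmap M l (k * l) (\<lambda>j\<in>{..l}. smash_pt l i j) m"


section \<open>Sheaves\<close>

locale sheaf_of_sets =
  fixes X :: "'p topology" and F :: "'p set \<Rightarrow> 'a set" and r :: "'p set \<Rightarrow> 'p set \<Rightarrow> 'a \<Rightarrow> 'a"
  assumes res_closed: "openin X U \<Longrightarrow> openin X V \<Longrightarrow> V \<subseteq> U \<Longrightarrow> s \<in> F U \<Longrightarrow> r U V s \<in> F V"
    and res_id: "openin X U \<Longrightarrow> s \<in> F U \<Longrightarrow> r U U s = s"
    and res_comp: "openin X U \<Longrightarrow> openin X V \<Longrightarrow> openin X W \<Longrightarrow> W \<subseteq> V \<Longrightarrow> V \<subseteq> U \<Longrightarrow> s \<in> F U \<Longrightarrow>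
      r V W (r U V s) = r U W s"
    and glue: "(\<And>V. V \<in> \<U> \<Longrightarrow> openin X V) \<Longrightarrow> (\<And>V. V \<in> \<U> \<Longrightarrow> \<sigma> V \<in> F V) \<Longrightarrow>
      (\<And>V W. V \<in> \<U> \<Longrightarrow> W \<in> \<U> \<Longrightarrow> r V (V \<inter> W) (\<sigma> V) = r W (V \<inter> W) (\<sigma> W)) \<Longrightarrow>
      \<exists>!t. t \<in> F (\<Union>\<U>) \<and> (\<forall>V\<in>\<U>. r (\<Union>\<U>) V t = \<sigma> V)"

text \<open>
  Limits of \<open>\<S>\<close>-algebras and of modules are computed pointwise on underlying
  sets, so the sheaf condition is imposed on \<open>U \<mapsto> A(U)(k\<^sub>+)\<close> for each \<open>k\<close>.
\<close>

locale sheaf_of_s_algebras =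
  fixes X :: "'p topology" and A :: "'p set \<Rightarrow> ('a, 'x) s_algebra_scheme"
    and r :: "'p set \<Rightarrow> 'p set \<Rightarrow> nat \<Rightarrow> 'a \<Rightarrow> 'a"
  assumes s_algebra: "openin X U \<Longrightarrow> s_algebra (A U)"
    and res_morphism: "openin X U \<Longrightarrow> openin X V \<Longrightarrow> V \<subseteq> U \<Longrightarrow>
      s_algebra_morphism (A U) (A V) (r U V)"
    and sheaf: "sheaf_of_sets X (\<lambda>U. gob (A U) k) (\<lambda>U V. r U V k)"

locale sheaf_of_s_modules = A: sheaf_of_s_algebras X A r
  for X :: "'p topology" and A :: "'p set \<Rightarrow> ('a, 'x) s_algebra_scheme"
    and r :: "'p set \<Rightarrow> 'p set \<Rightarrow> nat \<Rightarrow> 'a \<Rightarrow> 'a" +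
  fixes M :: "'p set \<Rightarrow> ('a, 'm, 'y) s_module_scheme"
    and q :: "'p set \<Rightarrow> 'p set \<Rightarrow> nat \<Rightarrow> 'm \<Rightarrow> 'm"
  assumes s_module: "openin X U \<Longrightarrow> s_module (A U) (M U)"
    and mod_res_morphism: "openin X U \<Longrightarrow> openin X V \<Longrightarrow> V \<subseteq> U \<Longrightarrow>
      gamma_morphism (M U) (M V) (q U V)"
    and mod_res_act: "openin X U \<Longrightarrow> openin X V \<Longrightarrow> V \<subseteq> U \<Longrightarrow>
      x \<in> gob (A U) k \<Longrightarrow> m \<in> gob (M U) l \<Longrightarrow>
      q U V (k * l) (sact (M U) k l x m) = sact (M V) k l (r U V k x) (q U V l m)"
    and mod_sheaf: "sheaf_of_sets X (\<lambda>U. gob (M U) k) (\<lambda>U V. q U V k)"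


section \<open>Eilenberg--MacLane objects and their norm-bounded parts\<close>

text \<open>
  \<open>R\<close> is a subsemiring and \<open>E\<close> an \<open>R\<close>-submodule of an ambient semiring.  An element of
  \<open>R\<close> to the power \<open>{1..k}\<close> is a function on \<open>nat\<close> that vanishes outside \<open>{1..k}\<close>.
\<close>

definition H_gamma :: "'r::semiring_1 set \<Rightarrow> (nat \<Rightarrow> 'r) gamma_set" where
  "H_gamma E = \<lparr>
     gob = (\<lambda>k. {\<phi>. (\<forall>x\<in>{1..k}. \<phi> x \<in> E) \<and> (\<forall>x. x \<notin> {1..k} \<longrightarrow> \<phi> x = 0)}),
     gbase = (\<lambda>k x. 0),
     gmap = (\<lambda>k l f \<phi> y. if y \<in> {1..l} then \<Sum>x\<in>{x\<in>{..k}. f x = y}. \<phi> x else 0)\<rparr>"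

definition H_mult :: "nat \<Rightarrow> nat \<Rightarrow> (nat \<Rightarrow> 'r::semiring_1) \<Rightarrow> (nat \<Rightarrow> 'r) \<Rightarrow> nat \<Rightarrow> 'r" where
  "H_mult k l \<phi> \<psi> n = (if n \<in> {1..k * l} then \<phi> (smash_fst l n) * \<psi> (smash_snd l n) else 0)"

definition H_alg :: "'r::semiring_1 set \<Rightarrow> (nat \<Rightarrow> 'r) s_algebra" where
  "H_alg R = gamma_set.extend (H_gamma R)
     \<lparr>sunit = (\<lambda>k i x. if x \<in> {1..k} \<and> x = i then 1 else 0), smult = H_mult\<rparr>"

definition H_mod :: "'r::semiring_1 set \<Rightarrow> (nat \<Rightarrow> 'r, nat \<Rightarrow> 'r) s_module" where
  "H_mod E = gamma_set.extend (H_gamma E) \<lparr>sact = H_mult\<rparr>"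

definition norm_ball ::
  "real \<Rightarrow> (nat \<Rightarrow> rat, 'x) gamma_set_scheme \<Rightarrow> (nat \<Rightarrow> rat, 'x) gamma_set_scheme" where
  "norm_ball c F = F\<lparr>gob := (\<lambda>k. {\<phi> \<in> gob F k. (\<Sum>x\<in>{1..k}. real_of_rat \<bar>\<phi> x\<bar>) \<le> c})\<rparr>"

text \<open>The one-point \<open>\<S>\<close>-algebra and module (values on the empty set).\<close>

definition point_alg :: "(nat \<Rightarrow> rat) s_algebra" where
  "point_alg = \<lparr>gob = (\<lambda>k. {\<lambda>x. 0}), gbase = (\<lambda>k x. 0), gmap = (\<lambda>k l f \<phi> x. 0),
     sunit = (\<lambda>k i x. 0), smult = (\<lambda>k l \<phi> \<psi> x. 0)\<rparr>"

definition point_mod :: "(nat \<Rightarrow> rat, nat \<Rightarrow> rat) s_module" where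
  "point_mod = \<lparr>gob = (\<lambda>k. {\<lambda>x. 0}), gbase = (\<lambda>k x. 0), gmap = (\<lambda>k l f \<phi> x. 0),
     sact = (\<lambda>k l \<phi> \<psi> x. 0)\<rparr>"


section \<open>The spaces \<open>Spec \<int>\<close> and its compactification\<close>

text \<open>Only the points \<open>Prime_pt p\<close> with \<open>p\<close> prime belong to the spaces below.\<close>

datatype arith_point = Generic_pt | Prime_pt nat | Infinity_pt

definition specZ :: "arith_point set" where
  "specZ = insert Generic_pt (Prime_pt ` {p. prime p})"

definition specZ_bar :: "arith_point set" where
  "specZ_bar = insert Infinity_pt specZ"

definition open_specZ_bar :: "arith_point set \<Rightarrow> bool" where
  "open_specZ_bar U \<longleftrightarrow>
     U = {} \<or> (\<exists>F. finite F \<and> F \<subseteq> specZ_bar - {Generic_pt} \<and> U = specZ_bar - F)"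

definition specZ_bar_top :: "arith_point topology" where
  "specZ_bar_top = topology open_specZ_bar"

text \<open>The prime ideal of a point of \<open>Spec \<int>\<close>; the value at \<open>Infinity_pt\<close> is irrelevant.\<close>

fun prime_ideal_of :: "arith_point \<Rightarrow> int set" where
  "prime_ideal_of (Prime_pt p) = {n. int p dvd n}"
| "prime_ideal_of _ = {0}"

definition zariski_closed :: "int set \<Rightarrow> arith_point set" where
  "zariski_closed S = {x \<in> specZ. S \<subseteq> prime_ideal_of x}"

definition specZ_top :: "arith_point topology" where
  "specZ_top = topology (\<lambda>U. \<exists>S. U = specZ - zariski_closed S)"

lemma istopology_specZ_bar: "istopology open_specZ_bar"
  unfolding istopology_def
proof (intro conjI allI impI)
  fix S T assume "open_specZ_bar S" "open_specZ_bar T"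
  then show "open_specZ_bar (S \<inter> T)"
    unfolding open_specZ_bar_def
  proof (elim disjE exE conjE)
    fix F G
    assume "finite F" "F \<subseteq> specZ_bar - {Generic_pt}" "S = specZ_bar - F"
      "finite G" "G \<subseteq> specZ_bar - {Generic_pt}" "T = specZ_bar - G"
    then show "S \<inter> T = {} \<or>
        (\<exists>F. finite F \<and> F \<subseteq> specZ_bar - {Generic_pt} \<and> S \<inter> T = specZ_bar - F)"
      by (intro disjI2 exI[of _ "F \<union> G"]) auto
  qed auto
next
  fix \<K> assume o: "\<forall>K\<in>\<K>. open_specZ_bar K"
  show "open_specZ_bar (\<Union>\<K>)"
  proof (cases "\<Union>\<K> = {}")
    case True
    then show ?thesis by (simp add: open_specZ_bar_def)
  next
    case False
    then obtain K where K: "K \<in> \<K>" "K \<noteq> {}" by auto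
    then obtain F where F: "finite F" "F \<subseteq> specZ_bar - {Generic_pt}" "K = specZ_bar - F"
      using o unfolding open_specZ_bar_def by metis
    have "\<Union>\<K> \<subseteq> specZ_bar" using o unfolding open_specZ_bar_def by blast
    then have "\<Union>\<K> = specZ_bar - (F - \<Union>\<K>)" using F K by blast
    then show ?thesis unfolding open_specZ_bar_def using F by blast
  qed
qed

lemma openin_specZ_bar_top:
  "openin specZ_bar_top U \<longleftrightarrow>
     U = {} \<or> (\<exists>F. finite F \<and> F \<subseteq> specZ_bar - {Generic_pt} \<and> U = specZ_bar - F)"
  using topology_inverse'[OF istopology_specZ_bar]
  by (simp add: specZ_bar_top_def open_specZ_bar_def)

lemma zariski_opens:
  "(\<exists>S. U = specZ - zariski_closed S) \<longleftrightarrow> open_specZ_bar U \<and> Infinity_pt \<notin> U" (is "?L \<longleftrightarrow> ?R")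
proof
  assume ?L
  then obtain S where U: "U = specZ - zariski_closed S" by blast
  have inf: "Infinity_pt \<notin> U" by (auto simp: U specZ_def)
  show ?R
  proof (cases "S \<subseteq> {0}")
    case True
    then have "0 \<in> prime_ideal_of x \<Longrightarrow> S \<subseteq> prime_ideal_of x" for x by auto
    moreover have "0 \<in> prime_ideal_of x" for x by (cases x) auto
    ultimately have "U = {}" by (auto simp: U zariski_closed_def)
    then show ?thesis by (simp add: open_specZ_bar_def)
  next
    case False
    then obtain n where n: "n \<in> S" "n \<noteq> 0" by auto
    have "zariski_closed S \<subseteq> Prime_pt ` {p. p dvd nat \<bar>n\<bar>}"
    proof
      fix x assume x: "x \<in> zariski_closed S"
      then have "n \<in> prime_ideal_of x" "x \<noteq> Infinity_pt"
        using n by (auto simp: zariski_closed_def specZ_def)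
      then obtain p where "x = Prime_pt p" "int p dvd n" using n by (cases x) auto
      then show "x \<in> Prime_pt ` {p. p dvd nat \<bar>n\<bar>}"
        by (auto simp: int_dvd_int_iff[symmetric])
    qed
    moreover have "finite (Prime_pt ` {p. p dvd nat \<bar>n\<bar>})"
      using n by (intro finite_imageI finite_divisors_nat) simp
    ultimately have "finite (insert Infinity_pt (zariski_closed S))"
      and g: "Generic_pt \<notin> zariski_closed S" by (auto dest: finite_subset)
    moreover have "U = specZ_bar - insert Infinity_pt (zariski_closed S)"
      using inf by (auto simp: U specZ_bar_def)
    moreover have "insert Infinity_pt (zariski_closed S) \<subseteq> specZ_bar - {Generic_pt}"
      using g by (auto simp: specZ_bar_def zariski_closed_def)
    ultimately show ?thesis using inf unfolding open_specZ_bar_def by blast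
  qed
next
  assume R: ?R
  show ?L
  proof (cases "U = {}")
    case True
    then show ?thesis by (intro exI[of _ "{}"]) (auto simp: zariski_closed_def)
  next
    case False
    then obtain F where F: "finite F" "F \<subseteq> specZ_bar - {Generic_pt}" "U = specZ_bar - F"
      and inf: "Infinity_pt \<notin> U" using R unfolding open_specZ_bar_def by blast
    define P where "P = {p. Prime_pt p \<in> F}"
    have P: "finite P" "\<And>p. p \<in> P \<Longrightarrow> prime p"
      using F finite_vimageI[of F Prime_pt]
      by (auto simp: P_def vimage_def inj_def specZ_bar_def specZ_def)
    have "0 \<notin> P" using P(2) not_prime_0 by blast
    then have "prod int P \<noteq> 0" using P(1) by auto
    then have gen: "Generic_pt \<notin> zariski_closed {prod int P}" by (auto simp: zariski_closed_def)
    have "Prime_pt p \<in> zariski_closed {prod int P} \<longleftrightarrow> p \<in> P" for p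
    proof -
      have e: "prod int P = int (\<Prod>P)" by simp
      have "p dvd \<Prod>P \<longleftrightarrow> p \<in> P" if p: "prime p"
      proof
        assume "p dvd \<Prod>P"
        then obtain x where "x \<in> P" "p dvd x" using p P(1) by (auto simp: prime_dvd_prod_iff)
        then show "p \<in> P" using primes_dvd_imp_eq[OF p P(2)] by blast
      qed (use P(1) in \<open>rule dvd_prodI\<close>)
      then show ?thesis
        using P(2) unfolding zariski_closed_def specZ_def e by (auto simp del: of_nat_prod)
    qed
    then have "x \<in> U \<longleftrightarrow> x \<in> specZ - zariski_closed {prod int P}" for x
      using F inf gen by (cases x) (auto simp: P_def specZ_bar_def specZ_def)
    then show ?thesis by blast
  qed
qed

lemma openin_specZ_top:
  "openin specZ_top U \<longleftrightarrow> openin specZ_bar_top U \<and> Infinity_pt \<notin> U"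
proof -
  have "istopology (\<lambda>U. open_specZ_bar U \<and> Infinity_pt \<notin> U)"
    using istopology_specZ_bar unfolding istopology_def by simp
  then show ?thesis
    by (simp add: specZ_top_def zariski_opens specZ_bar_top_def topology_inverse'
        istopology_specZ_bar)
qed


section \<open>Structure sheaf and sheaves of Arakelov divisors\<close>

definition rat_valuation :: "nat \<Rightarrow> rat \<Rightarrow> int" where
  "rat_valuation p q =
     int (multiplicity (int p) (fst (quotient_of q))) - int (multiplicity (int p) (snd (quotient_of q)))"

text \<open>Sections of the structure sheaf of \<open>Spec \<int>\<close> over a non-empty open set.\<close>

definition O_specZ :: "arith_point set \<Rightarrow> rat set" where
  "O_specZ V = {q. \<forall>p. prime p \<longrightarrow> int p dvd snd (quotient_of q) \<longrightarrow> Prime_pt p \<in> specZ - V}"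

definition H_O_specZ :: "arith_point set \<Rightarrow> (nat \<Rightarrow> rat) s_algebra" where
  "H_O_specZ V = (if V = {} then point_alg else H_alg (O_specZ V))"

definition O_specZ_bar :: "arith_point set \<Rightarrow> (nat \<Rightarrow> rat) s_algebra" where
  "O_specZ_bar U =
     (if Infinity_pt \<in> U then norm_ball 1 (H_O_specZ (U \<inter> specZ)) else H_O_specZ U)"

text \<open>The divisor \<open>\<Sum>\<^sub>p n\<^sub>p {p}\<close> is the function \<open>p \<mapsto> n\<^sub>p\<close>.\<close>

definition is_divisor :: "(nat \<Rightarrow> int) \<Rightarrow> bool" where
  "is_divisor n \<longleftrightarrow> finite {p. n p \<noteq> 0} \<and> (\<forall>p. n p \<noteq> 0 \<longrightarrow> prime p)"

record arakelov_divisor =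
  fin_part :: "nat \<Rightarrow> int"
  inf_coeff :: real

definition is_arakelov_divisor :: "arakelov_divisor \<Rightarrow> bool" where
  "is_arakelov_divisor D \<longleftrightarrow> is_divisor (fin_part D)"

text \<open>Sections of \<open>\<O>(D\<^sub>f\<^sub>i\<^sub>n)\<close> over a non-empty open set.\<close>

definition O_div :: "(nat \<Rightarrow> int) \<Rightarrow> arith_point set \<Rightarrow> rat set" where
  "O_div n V = {q. q = 0 \<or> (\<forall>p. prime p \<longrightarrow> Prime_pt p \<in> V \<longrightarrow> rat_valuation p q + n p \<ge> 0)}"

definition H_O_div :: "(nat \<Rightarrow> int) \<Rightarrow> arith_point set \<Rightarrow> (nat \<Rightarrow> rat, nat \<Rightarrow> rat) s_module" where
  "H_O_div n V = (if V = {} then point_mod else H_mod (O_div n V))"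

definition O_arakelov ::
  "arakelov_divisor \<Rightarrow> arith_point set \<Rightarrow> (nat \<Rightarrow> rat, nat \<Rightarrow> rat) s_module" where
  "O_arakelov D U =
     (if Infinity_pt \<in> U
      then norm_ball (exp (inf_coeff D)) (H_O_div (fin_part D) (U \<inter> specZ))
      else H_O_div (fin_part D) U)"

text \<open>Restriction maps: inclusions inside \<open>H\<rat>\<close>, except for the map to the one-point value on \<open>{}\<close>.\<close>

definition arith_res ::
  "arith_point set \<Rightarrow> arith_point set \<Rightarrow> nat \<Rightarrow> (nat \<Rightarrow> rat) \<Rightarrow> nat \<Rightarrow> rat" where
  "arith_res U V k \<phi> = (if V = {} then (\<lambda>x. 0) else \<phi>)"

end

theory Submission
  imports Defs
begin

text \<open>
  All values on non-empty opens are sub-\<open>\<Gamma>\<close>-sets of \<open>H\<rat>\<close> with the inherited operations, so the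
  algebra and module axioms need to be checked for \<open>H\<rat>\<close> only, and what remains is closure.  The bound
  at \<open>\<infinity>\<close> is preserved because the \<open>\<ell>\<^sup>1\<close>-norm does not increase under summation over fibres and is
  multiplicative under the smash product; the conditions at the primes are those of the \<open>p\<close>-adic
  valuations, and \<open>\<O>\<close> is the case \<open>D = 0\<close>.  The sheaf axiom holds because any two non-empty opens
  share the generic point, so that compatible sections coincide inside \<open>H\<rat>\<close>, and because membership
  is a conjunction of conditions, one for each point of the open set.
\<close>

section \<open>Eilenberg--MacLane objects\<close>

lemma smash_pt_in: "i \<in> {1..k} \<Longrightarrow> j \<in> {1..l} \<Longrightarrow> smash_pt l i j \<in> {1..k * l}"
  using smash_pt_bij[of l k] unfolding bij_betw_def by (metis SigmaI case_prod_conv image_eqI)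

lemma smash_pt_cases:
  assumes "n \<in> {1..k * l}"
  obtains i j where "i \<in> {1..k}" "j \<in> {1..l}" "n = smash_pt l i j"
  using smash_pt_fst_snd[OF assms] by metis

text \<open>Only the right-hand pair has to avoid the base point: if \<open>i\<close> or
  \<open>j\<close> is 0, the left side is 0 and the right side is not. So it applies to
  \<open>f i\<close> and \<open>g j\<close>, which may be base points.\<close>

lemma smash_pt_eq_iff:
  assumes "1 \<le> i'" "j' \<in> {1..l}" "j \<le> l"
  shows "smash_pt l i j = smash_pt l i' j' \<longleftrightarrow> i = i' \<and> j = j'"
proof
  assume e: "smash_pt l i j = smash_pt l i' j'"
  have "smash_pt l i' j' \<noteq> 0" using assms by (auto simp: smash_pt_def)
  then have "1 \<le> i" "1 \<le> j" using e by (auto simp: smash_pt_def split: if_splits)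
  then show "i = i' \<and> j = j'"
    using e assms smash_fst_pt smash_snd_pt by (metis atLeastAtMost_iff)
qed simp

text \<open>Turns a sum over a smash product into a double sum, so that fibre sums and norms of
  products factor.\<close>

lemma sum_smash:
  fixes h :: "nat \<Rightarrow> 'b::comm_monoid_add"
  shows "(\<Sum>n=1..k*l. h n) = (\<Sum>i=1..k. \<Sum>j=1..l. h (smash_pt l i j))"
proof -
  have "(\<Sum>n=1..k*l. h n) = (\<Sum>(i, j)\<in>{1..k} \<times> {1..l}. h (smash_pt l i j))"
    using sum.reindex_bij_betw[OF smash_pt_bij[of l k], of h] by (simp add: case_prod_unfold)
  then show ?thesis by (simp add: sum.cartesian_product)
qed

lemma smash_left_in_pointed_maps:
  "i \<le> k \<Longrightarrow> (\<lambda>j\<in>{..l}. smash_pt l i j) \<in> pointed_maps l (k * l)"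
  using smash_pt_in[of i k _ l] by (force simp: pointed_maps_def smash_pt_def)

lemma smash_right_in_pointed_maps:
  "i \<le> k \<Longrightarrow> (\<lambda>j\<in>{..l}. smash_pt k j i) \<in> pointed_maps l (l * k)"
  using smash_pt_in[of _ l i k] by (force simp: pointed_maps_def smash_pt_def)

lemma smash_map_in_pointed_maps:
  assumes "f \<in> pointed_maps k k'" "g \<in> pointed_maps l l'"
  shows "smash_map k l l' f g \<in> pointed_maps (k * l) (k' * l')"
proof -
  have "smash_map k l l' f g n \<le> k' * l'" if "n \<le> k * l" for n
  proof (cases "n = 0")
    case False
    then have n: "n \<in> {1..k * l}" using that by auto
    then obtain i j where ij: "i \<in> {1..k}" "j \<in> {1..l}" "n = smash_pt l i j"
      by (rule smash_pt_cases)
    have "smash_map k l l' f g n = smash_pt l' (f i) (g j)"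
      using ij assms by (simp add: smash_map_pt)
    moreover have "f i \<le> k'" "g j \<le> l'" using ij assms by (auto simp: pointed_maps_def)
    ultimately show ?thesis using smash_pt_in[of "f i" k' "g j" l']
      by (cases "f i = 0 \<or> g j = 0") (auto simp: smash_pt_def)
  qed (simp add: smash_map_def)
  then show ?thesis by (auto simp: pointed_maps_def smash_map_def)
qed

section \<open>Fibre sums, functoriality, product and unit\<close>

lemma gob_H_gamma:
  "\<phi> \<in> gob (H_gamma E) k \<longleftrightarrow> (\<forall>x\<in>{1..k}. \<phi> x \<in> E) \<and> (\<forall>x. x \<notin> {1..k} \<longrightarrow> \<phi> x = 0)"
  by (simp add: H_gamma_def)

lemma gmap_H_outside: "y \<notin> {1..l} \<Longrightarrow> gmap (H_gamma E) k l f \<phi> y = 0"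
  by (auto simp: H_gamma_def)

text \<open>The fibre sum becomes an indicator sum over a fixed range, ready for exchanging sums.
  The base point drops out of the index set because \<open>f 0 = 0\<close> while \<open>y\<close> is
  positive.\<close>

lemma gmap_H:
  assumes "f \<in> pointed_maps k l" "y \<in> {1..l}"
  shows "gmap (H_gamma E) k l f \<phi> y = (\<Sum>x=1..k. if f x = y then \<phi> x else 0)"
proof -
  have "f 0 = 0" using assms by (simp add: pointed_maps_def)
  then have "{x \<in> {..k}. f x = y} = {x \<in> {1..k}. f x = y}"
    using assms by (auto simp: Suc_le_eq intro: gr0I)
  then show ?thesis using assms by (simp add: H_gamma_def sum.If_cases Int_def)
qed

lemma H_mult_pt:
  "i \<in> {1..k} \<Longrightarrow> j \<in> {1..l} \<Longrightarrow> H_mult k l \<phi> \<psi> (smash_pt l i j) = \<phi> i * \<psi> j"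
  using smash_pt_in[of i k j l] by (simp add: H_mult_def smash_fst_pt smash_snd_pt)

lemma H_mult_outside: "n \<notin> {1..k * l} \<Longrightarrow> H_mult k l \<phi> \<psi> n = 0"
  by (auto simp: H_mult_def)

lemma H_mult_mem:
  assumes "n \<in> {1..k * l}" "\<forall>x\<in>{1..k}. \<phi> x \<in> E" "\<forall>x\<in>{1..l}. \<psi> x \<in> E'"
    and "\<And>a b. a \<in> E \<Longrightarrow> b \<in> E' \<Longrightarrow> a * b \<in> E''"
  shows "H_mult k l \<phi> \<psi> n \<in> E''"
  using assms smash_pt_fst_snd(1,2)[OF assms(1)] by (auto simp: H_mult_def)

lemma gamma_set_H: "gamma_set (H_gamma (UNIV :: 'r::semiring_1 set))"
proof
  let ?F = "H_gamma (UNIV :: 'r set)"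
  fix k l m f g x
  show "gbase ?F k \<in> gob ?F k" "gob ?F 0 = {gbase ?F 0}" by (auto simp: H_gamma_def)
  show "gmap ?F k l f x \<in> gob ?F l" by (auto simp: gob_H_gamma gmap_H_outside)
  show "gmap ?F k l f (gbase ?F k) = gbase ?F l" by (auto simp: H_gamma_def)
  {
    assume x: "x \<in> gob ?F k"
    show "gmap ?F k k (\<lambda>i\<in>{..k}. i) x = x"
    proof
      fix y
      have "{i \<in> {..k}. restrict (\<lambda>i. i) {..k} i = y} = {y}" if "y \<in> {1..k}"
        using that by auto
      then show "gmap ?F k k (\<lambda>i\<in>{..k}. i) x y = x y"
        using x by (cases "y \<in> {1..k}") (auto simp: H_gamma_def)
    qed
  }
  assume f: "f \<in> pointed_maps k l" and g: "g \<in> pointed_maps l m"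
  then have gf: "compose {..k} g f \<in> pointed_maps k m"
    by (auto simp: pointed_maps_def compose_def PiE_iff)
  show "gmap ?F k m (compose {..k} g f) x = gmap ?F l m g (gmap ?F k l f x)"
  proof
    fix y
    show "gmap ?F k m (compose {..k} g f) x y = gmap ?F l m g (gmap ?F k l f x) y"
    proof (cases "y \<in> {1..m}")
      case True
      have fibre: "(\<Sum>j=1..l. if g j = y then (if f i = j then x i else 0) else 0)
          = (if g (f i) = y then x i else 0)" if "i \<in> {1..k}" for i
      proof -
        have "(\<Sum>j=1..l. if g j = y then (if f i = j then x i else 0) else 0)
            = (\<Sum>j=1..l. if f i = j then (if g (f i) = y then x i else 0) else 0)"
          by (rule sum.cong) auto
        \<comment> \<open>If \<open>f i\<close> is the base point, no \<open>j\<close> in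
          \<open>{1..l}\<close> matches it; the right side vanishes too, as then
          \<open>g (f i) = 0\<close> differs from \<open>y\<close>.\<close>
        moreover have "f i \<in> {1..l} \<or> g (f i) \<noteq> y"
          using f g True that by (cases "f i = 0") (auto simp: pointed_maps_def)
        ultimately show ?thesis by auto
      qed
      have "gmap ?F l m g (gmap ?F k l f x) y
          = (\<Sum>j=1..l. if g j = y then (\<Sum>i=1..k. if f i = j then x i else 0) else 0)"
        by (subst gmap_H[OF g True]) (rule sum.cong, auto simp: gmap_H[OF f])
      also have "\<dots> = (\<Sum>j=1..l. \<Sum>i=1..k. if g j = y then (if f i = j then x i else 0) else 0)"
        by (rule sum.cong) auto
      also have "\<dots> = (\<Sum>i=1..k. \<Sum>j=1..l. if g j = y then (if f i = j then x i else 0) else 0)"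
        by (rule sum.swap)
      also have "\<dots> = (\<Sum>i=1..k. if g (f i) = y then x i else 0)"
        by (rule sum.cong[OF refl], rule fibre)
      also have "\<dots> = gmap ?F k m (compose {..k} g f) x y"
        by (subst gmap_H[OF gf True]) (rule sum.cong, auto simp: compose_def)
      finally show ?thesis by simp
    qed (simp add: gmap_H_outside)
  qed
qed

text \<open>The fibre of a smash of maps over a point other than the base point is the product of
  the two fibres, so distributivity makes the sum of products a product of sums. The sets
  \<open>E\<close>, \<open>E'\<close>, \<open>E''\<close> are independent because
  \<open>gmap\<close> does not depend on them.\<close>

lemma gmap_smash_H_mult:
  fixes \<phi> \<psi> :: "nat \<Rightarrow> 'r::semiring_1"
  assumes f: "f \<in> pointed_maps k k'" and g: "g \<in> pointed_maps l l'"
  shows "gmap (H_gamma E) (k * l) (k' * l') (smash_map k l l' f g) (H_mult k l \<phi> \<psi>)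
    = H_mult k' l' (gmap (H_gamma E') k k' f \<phi>) (gmap (H_gamma E'') l l' g \<psi>)"
proof
  fix n
  show "gmap (H_gamma E) (k * l) (k' * l') (smash_map k l l' f g) (H_mult k l \<phi> \<psi>) n
    = H_mult k' l' (gmap (H_gamma E') k k' f \<phi>) (gmap (H_gamma E'') l l' g \<psi>) n"
  proof (cases "n \<in> {1..k' * l'}")
    case True
    then obtain i' j' where n: "i' \<in> {1..k'}" "j' \<in> {1..l'}" "n = smash_pt l' i' j'"
      by (rule smash_pt_cases)
    have eq: "smash_map k l l' f g (smash_pt l i j) = n \<longleftrightarrow> f i = i' \<and> g j = j'"
      if "i \<in> {1..k}" "j \<in> {1..l}" for i j
    proof -
      have "g j \<le> l'" using g that by (auto simp: pointed_maps_def)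
      then show ?thesis using that n by (simp add: smash_map_pt[OF f g] smash_pt_eq_iff)
    qed
    have "gmap (H_gamma E) (k * l) (k' * l') (smash_map k l l' f g) (H_mult k l \<phi> \<psi>) n
        = (\<Sum>i=1..k. \<Sum>j=1..l. if smash_map k l l' f g (smash_pt l i j) = n
             then H_mult k l \<phi> \<psi> (smash_pt l i j) else 0)"
      by (simp only: gmap_H[OF smash_map_in_pointed_maps[OF f g] True] sum_smash)
    also have "\<dots> = (\<Sum>i=1..k. \<Sum>j=1..l.
        (if f i = i' then \<phi> i else 0) * (if g j = j' then \<psi> j else 0))"
      by (intro sum.cong refl) (auto simp: eq H_mult_pt)
    also have "\<dots> = H_mult k' l' (gmap (H_gamma E') k k' f \<phi>) (gmap (H_gamma E'') l l' g \<psi>) n"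
      using n by (simp add: H_mult_pt gmap_H[OF f] gmap_H[OF g] sum_product)
    finally show ?thesis .
  qed (simp add: gmap_H_outside H_mult_outside)
qed

lemma day_morphism_H_mult:
  "day_morphism (H_gamma (UNIV :: 'r::semiring_1 set)) (H_gamma UNIV) (H_gamma UNIV) H_mult"
  unfolding day_morphism_def
proof (intro conjI allI ballI)
  fix k l k' l' f g and x y :: "nat \<Rightarrow> 'r"
  show "H_mult k l x y \<in> gob (H_gamma UNIV) (k * l)" by (auto simp: gob_H_gamma H_mult_outside)
  show "H_mult k l (gbase (H_gamma UNIV) k) y = gbase (H_gamma UNIV) (k * l)"
    "H_mult k l x (gbase (H_gamma UNIV) l) = gbase (H_gamma UNIV) (k * l)"
    by (auto simp: H_gamma_def H_mult_def)
qed (rule gmap_smash_H_mult)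

text \<open>An index splits as \<open>(h, i), j\<close>, and strict associativity of
  \<open>smash_pt\<close> lets the same number be read as \<open>h, (i, j)\<close>. What is left is
  associativity in the semiring.\<close>

lemma H_mult_assoc:
  fixes x y z :: "nat \<Rightarrow> 'r::semiring_1"
  shows "H_mult (k * l) m (H_mult k l x y) z = H_mult k (l * m) x (H_mult l m y z)"
proof
  fix n
  show "H_mult (k * l) m (H_mult k l x y) z n = H_mult k (l * m) x (H_mult l m y z) n"
  proof (cases "n \<in> {1..k * l * m}")
    case True
    then obtain n' j where n: "n' \<in> {1..k * l}" "j \<in> {1..m}" "n = smash_pt m n' j"
      by (rule smash_pt_cases)
    from n(1) obtain h i where n': "h \<in> {1..k}" "i \<in> {1..l}" "n' = smash_pt l h i"
      by (rule smash_pt_cases)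
    have "H_mult (k * l) m (H_mult k l x y) z n = x h * y i * z j"
      using n n' by (simp add: H_mult_pt)
    moreover have "H_mult k (l * m) x (H_mult l m y z) n = x h * (y i * z j)"
      using n n' smash_pt_in[of i l j m] by (simp add: smash_pt_assoc H_mult_pt)
    ultimately show ?thesis by (simp add: mult.assoc)
  next
    case False
    then have out: "n \<notin> {1..k * (l * m)}" by (simp only: mult.assoc not_False_eq_True)
    show ?thesis unfolding H_mult_outside[OF False] H_mult_outside[OF out] ..
  qed
qed

text \<open>Names the unit field of \<open>H_alg\<close>. The guard \<open>x \<in> {1..k}\<close>
  makes the base point \<open>i = 0\<close> go to the zero function.\<close>

definition H_unit :: "nat \<Rightarrow> nat \<Rightarrow> nat \<Rightarrow> 'r::semiring_1" where
  "H_unit k i x = (if x \<in> {1..k} \<and> x = i then 1 else 0)"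

text \<open>At the index with coordinates \<open>(i', j')\<close> both sides are \<open>x j'\<close>
  if \<open>i = i'\<close> and 0 otherwise; for \<open>i = 0\<close> both vanish everywhere.\<close>

lemma H_mult_unit_left:
  assumes "i \<le> k"
  shows "H_mult k l (H_unit k i) x = gmap (H_gamma E) l (k * l) (\<lambda>j\<in>{..l}. smash_pt l i j) x"
proof
  fix n
  show "H_mult k l (H_unit k i) x n
    = gmap (H_gamma E) l (k * l) (\<lambda>j\<in>{..l}. smash_pt l i j) x n"
  proof (cases "n \<in> {1..k * l}")
    case True
    then obtain i' j' where n: "i' \<in> {1..k}" "j' \<in> {1..l}" "n = smash_pt l i' j'"
      by (rule smash_pt_cases)
    have "gmap (H_gamma E) l (k * l) (\<lambda>j\<in>{..l}. smash_pt l i j) x n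
        = (\<Sum>j=1..l. if j = j' then (if i = i' then x j' else 0) else 0)"
      by (subst gmap_H[OF smash_left_in_pointed_maps[OF assms] True])
        (rule sum.cong, use n in \<open>auto simp: smash_pt_eq_iff\<close>)
    then show ?thesis using n by (auto simp: H_mult_pt H_unit_def)
  qed (simp add: gmap_H_outside H_mult_outside)
qed

lemma H_mult_unit_right:
  assumes "i \<le> k"
  shows "H_mult l k x (H_unit k i) = gmap (H_gamma E) l (l * k) (\<lambda>j\<in>{..l}. smash_pt k j i) x"
proof
  fix n
  show "H_mult l k x (H_unit k i) n
    = gmap (H_gamma E) l (l * k) (\<lambda>j\<in>{..l}. smash_pt k j i) x n"
  proof (cases "n \<in> {1..l * k}")
    case True
    then obtain j' i' where n: "j' \<in> {1..l}" "i' \<in> {1..k}" "n = smash_pt k j' i'"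
      by (rule smash_pt_cases)
    have "gmap (H_gamma E) l (l * k) (\<lambda>j\<in>{..l}. smash_pt k j i) x n
        = (\<Sum>j=1..l. if j = j' then (if i = i' then x j' else 0) else 0)"
      by (subst gmap_H[OF smash_right_in_pointed_maps[OF assms] True])
        (rule sum.cong, use n assms in \<open>auto simp: smash_pt_eq_iff\<close>)
    then show ?thesis using n by (auto simp: H_mult_pt H_unit_def)
  qed (simp add: gmap_H_outside H_mult_outside)
qed

lemma H_unit_natural:
  assumes "f \<in> pointed_maps k l" "i \<le> k"
  shows "H_unit l (f i) = gmap (H_gamma E) k l f (H_unit k i)"
proof
  fix y
  show "H_unit l (f i) y = gmap (H_gamma E) k l f (H_unit k i) y"
  proof (cases "y \<in> {1..l}")
    case True
    have "gmap (H_gamma E) k l f (H_unit k i) y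
        = (\<Sum>x=1..k. if x = i then (if f i = y then 1 else 0) else 0)"
      by (subst gmap_H[OF assms(1) True]) (rule sum.cong, auto simp: H_unit_def)
    \<comment> \<open>For \<open>i = 0\<close> the sum has no nonzero term, and
      \<open>f 0 = 0\<close> is not \<open>y\<close>, so both sides are 0.\<close>
    moreover have "i \<in> {1..k} \<or> f i \<noteq> y"
      using assms True by (cases "i = 0") (auto simp: pointed_maps_def)
    ultimately show ?thesis using True by (auto simp: H_unit_def)
  qed (auto simp: gmap_H_outside H_unit_def)
qed

section \<open>The ambient algebra and module\<close>

lemma H_alg_simps [simp]:
  "gob (H_alg R) = gob (H_gamma R)" "gbase (H_alg R) = gbase (H_gamma R)"
  "gmap (H_alg R) = gmap (H_gamma R)" "sunit (H_alg R) = H_unit" "smult (H_alg R) = H_mult"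
  by (auto simp: H_alg_def gamma_set.defs H_unit_def fun_eq_iff)

lemma H_mod_simps [simp]:
  "gob (H_mod R) = gob (H_gamma R)" "gbase (H_mod R) = gbase (H_gamma R)"
  "gmap (H_mod R) = gmap (H_gamma R)" "sact (H_mod R) = H_mult"
  by (auto simp: H_mod_def gamma_set.defs)

text \<open>\<open>H_alg\<close> and \<open>H_mod\<close> extend the record \<open>H_gamma\<close>
  and so have other types, but the axioms see only the three common fields.\<close>

lemma gamma_set_cong:
  assumes "gamma_set F" "gob G = gob F" "gbase G = gbase F" "gmap G = gmap F"
  shows "gamma_set G"
  using assms by (simp add: gamma_set_def)

lemma day_morphism_cong:
  assumes "day_morphism F F' F'' \<mu>"
    "gob G = gob F" "gbase G = gbase F" "gmap G = gmap F"
    "gob G' = gob F'" "gbase G' = gbase F'" "gmap G' = gmap F'"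
    "gob G'' = gob F''" "gbase G'' = gbase F''" "gmap G'' = gmap F''"
  shows "day_morphism G G' G'' \<mu>"
  using assms by (simp add: day_morphism_def)

lemma s_algebra_H: "s_algebra (H_alg (UNIV :: 'r::semiring_1 set))"
proof (intro s_algebra.intro s_algebra_axioms.intro)
  show "gamma_set (H_alg (UNIV :: 'r set))" by (rule gamma_set_cong[OF gamma_set_H]) auto
  show "day_morphism (H_alg UNIV) (H_alg UNIV) (H_alg (UNIV :: 'r set)) (smult (H_alg UNIV))"
    unfolding H_alg_simps by (rule day_morphism_cong[OF day_morphism_H_mult]) auto
  show "gamma_morphism sphere (H_alg (UNIV :: 'r set)) (sunit (H_alg UNIV))"
    by (auto simp: gamma_morphism_def sphere_def gob_H_gamma H_unit_natural)
      (auto simp: H_unit_def H_gamma_def fun_eq_iff)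
qed (simp_all add: H_mult_assoc H_mult_unit_left H_mult_unit_right)

lemma s_module_H: "s_module (H_alg UNIV) (H_mod (UNIV :: 'r::semiring_1 set))"
proof (intro s_module.intro s_module_axioms.intro)
  show "s_algebra (H_alg (UNIV :: 'r set))" by (rule s_algebra_H)
  show "gamma_set (H_mod (UNIV :: 'r set))" by (rule gamma_set_cong[OF gamma_set_H]) auto
  show "day_morphism (H_alg UNIV) (H_mod UNIV) (H_mod (UNIV :: 'r set)) (sact (H_mod UNIV))"
    unfolding H_mod_simps by (rule day_morphism_cong[OF day_morphism_H_mult]) auto
qed (simp_all add: H_mult_assoc H_mult_unit_left)

section \<open>Substructures\<close>

text \<open>The equations are inherited from \<open>F\<close>, which leaves closure. In degree 0 the
  value is squeezed between the base point and the singleton \<open>gob F 0\<close>.\<close>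

lemma gamma_subset:
  assumes "gamma_set F" "gbase G = gbase F" "gmap G = gmap F" "\<And>k. gob G k \<subseteq> gob F k"
    and "\<And>k. gbase F k \<in> gob G k"
    and "\<And>k l f x. f \<in> pointed_maps k l \<Longrightarrow> x \<in> gob G k \<Longrightarrow> gmap F k l f x \<in> gob G l"
  shows "gamma_set G"
proof -
  interpret F: gamma_set F by fact
  show ?thesis
  proof
    fix k l m f g x
    show "gob G 0 = {gbase G 0}" 
      using assms(2) assms(4,5)[of 0] F.zero by auto
    show "gbase G k \<in> gob G k" "f \<in> pointed_maps k l \<Longrightarrow> gmap G k l f (gbase G k) = gbase G l"
      "f \<in> pointed_maps k l \<Longrightarrow> x \<in> gob G k \<Longrightarrow> gmap G k l f x \<in> gob G l"
      using assms(2,3,5,6) F.map_base by simp_all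
    show "gmap G k m (compose {..k} g f) x = gmap G l m g (gmap G k l f x)"
      if "f \<in> pointed_maps k l" "g \<in> pointed_maps l m" "x \<in> gob G k"
      using that assms(3,4) F.map_comp by (simp add: subset_iff)
    show "gmap G k k (\<lambda>i\<in>{..k}. i) x = x" if "x \<in> gob G k"
      using that assms(3,4) F.map_id by (simp add: subset_iff)
  qed
qed

lemma day_morphism_subset:
  assumes "day_morphism F F' F'' \<mu>"
    and "gbase G = gbase F" "gmap G = gmap F" "\<And>k. gob G k \<subseteq> gob F k"
    and "gbase G' = gbase F'" "gmap G' = gmap F'" "\<And>k. gob G' k \<subseteq> gob F' k"
    and "gbase G'' = gbase F''" "gmap G'' = gmap F''"
    and "\<And>k l x y. x \<in> gob G k \<Longrightarrow> y \<in> gob G' l \<Longrightarrow> \<mu> k l x y \<in> gob G'' (k * l)"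
  shows "day_morphism G G' G'' \<mu>"
  using assms unfolding day_morphism_def by (simp add: subset_iff)

lemma s_subalgebra:
  assumes "s_algebra A" "gbase B = gbase A" "gmap B = gmap A" "sunit B = sunit A" "smult B = smult A"
    and sub: "\<And>k. gob B k \<subseteq> gob A k"
    and base: "\<And>k. gbase A k \<in> gob B k"
    and map: "\<And>k l f x. f \<in> pointed_maps k l \<Longrightarrow> x \<in> gob B k \<Longrightarrow> gmap A k l f x \<in> gob B l"
    and unit: "\<And>k i. i \<le> k \<Longrightarrow> sunit A k i \<in> gob B k"
    and mult: "\<And>k l x y. x \<in> gob B k \<Longrightarrow> y \<in> gob B l \<Longrightarrow> smult A k l x y \<in> gob B (k * l)"
  shows "s_algebra B"
proof -
  interpret A: s_algebra A by fact
  show ?thesis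
  proof (intro s_algebra.intro s_algebra_axioms.intro)
    show "gamma_set B" by (rule gamma_subset[OF A.gamma_set_axioms]) (use assms in auto)
    show "day_morphism B B B (smult B)" unfolding assms(5)
      by (rule day_morphism_subset[OF A.mult_morphism]) (use assms in auto)
    show "gamma_morphism sphere B (sunit B)" using A.unit_morphism assms
      by (simp add: gamma_morphism_def sphere_def)
  qed (use assms(2-5) sub A.mult_assoc A.unit_left A.unit_right in \<open>simp_all add: subset_iff\<close>)
qed

text \<open>Shrinks the scalars and the module at once, as is needed to pass from the ambient pair
  to the sections over an open set.\<close>

lemma s_submodule:
  assumes "s_module A M" "s_algebra B" "smult B = smult A" "sunit B = sunit A"
    and AB: "gbase B = gbase A" "gmap B = gmap A" "\<And>k. gob B k \<subseteq> gob A k"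
    and MN: "gbase N = gbase M" "gmap N = gmap M" "sact N = sact M" "\<And>k. gob N k \<subseteq> gob M k"
    and base: "\<And>k. gbase M k \<in> gob N k"
    and map: "\<And>k l f x. f \<in> pointed_maps k l \<Longrightarrow> x \<in> gob N k \<Longrightarrow> gmap M k l f x \<in> gob N l"
    and act: "\<And>k l x y. x \<in> gob B k \<Longrightarrow> y \<in> gob N l \<Longrightarrow> sact M k l x y \<in> gob N (k * l)"
  shows "s_module B N"
proof -
  interpret M: s_module A M by fact
  show ?thesis
  proof (intro s_module.intro s_module_axioms.intro)
    show "s_algebra B" by fact
    show "gamma_set N" by (rule gamma_subset[OF M.M.gamma_set_axioms]) (use assms in auto)
    show "day_morphism B N N (sact N)" unfolding MN(3)
      by (rule day_morphism_subset[OF M.act_morphism]) (use assms in auto)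
  qed (use assms(3,4) AB MN M.act_assoc M.act_unit in \<open>simp_all add: subset_iff\<close>)
qed

section \<open>Norms\<close>

definition l1_norm :: "nat \<Rightarrow> (nat \<Rightarrow> rat) \<Rightarrow> real" where
  "l1_norm k \<phi> = (\<Sum>x\<in>{1..k}. real_of_rat \<bar>\<phi> x\<bar>)"

lemma l1_norm_nonneg: "0 \<le> l1_norm k \<phi>"
  by (auto simp: l1_norm_def intro!: sum_nonneg)

text \<open>The triangle inequality is applied in each fibre; after exchanging the sums, every
  \<open>x\<close> counts at most once, and not at all if \<open>f\<close> sends it to the base
  point.\<close>

lemma l1_norm_gmap:
  assumes f: "f \<in> pointed_maps k l"
  shows "l1_norm l (gmap (H_gamma E) k l f \<phi>) \<le> l1_norm k \<phi>"
proof -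
  have "l1_norm l (gmap (H_gamma E) k l f \<phi>)
      \<le> (\<Sum>y=1..l. \<Sum>x=1..k. if f x = y then real_of_rat \<bar>\<phi> x\<bar> else 0)"
    unfolding l1_norm_def
  proof (rule sum_mono)
    fix y assume y: "y \<in> {1..l}"
    have "\<bar>\<Sum>x=1..k. if f x = y then \<phi> x else 0\<bar> \<le> (\<Sum>x=1..k. \<bar>if f x = y then \<phi> x else 0\<bar>)"
      by (rule sum_abs)
    then have "real_of_rat \<bar>gmap (H_gamma E) k l f \<phi> y\<bar>
        \<le> real_of_rat (\<Sum>x=1..k. \<bar>if f x = y then \<phi> x else 0\<bar>)"
      unfolding gmap_H[OF f y] by (simp add: of_rat_less_eq)
    also have "\<dots> = (\<Sum>x=1..k. if f x = y then real_of_rat \<bar>\<phi> x\<bar> else 0)"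
      unfolding of_rat_sum by (rule sum.cong) auto
    finally show "real_of_rat \<bar>gmap (H_gamma E) k l f \<phi> y\<bar>
        \<le> (\<Sum>x=1..k. if f x = y then real_of_rat \<bar>\<phi> x\<bar> else 0)" .
  qed
  also have "\<dots> = (\<Sum>x=1..k. \<Sum>y=1..l. if f x = y then real_of_rat \<bar>\<phi> x\<bar> else 0)"
    by (rule sum.swap)
  also have "\<dots> \<le> l1_norm k \<phi>"
    unfolding l1_norm_def by (rule sum_mono) auto
  finally show ?thesis .
qed

text \<open>The absolute value is multiplicative and the coordinates run over the full product.
  Hence radius 1 times radius \<open>c\<close> stays within radius \<open>c\<close>.\<close>

lemma l1_norm_H_mult: "l1_norm (k * l) (H_mult k l \<phi> \<psi>) = l1_norm k \<phi> * l1_norm l \<psi>"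
  unfolding l1_norm_def sum_smash sum_product
  by (intro sum.cong refl) (simp add: H_mult_pt abs_mult of_rat_mult)

lemma l1_norm_H_unit: "l1_norm k (H_unit k i) \<le> 1"
proof -
  have "l1_norm k (H_unit k i) = (\<Sum>x=1..k. if x = i then 1 else 0)"
    unfolding l1_norm_def by (rule sum.cong) (auto simp: H_unit_def)
  then show ?thesis by simp
qed

section \<open>Valuations\<close>

text \<open>Frees the valuation from reduced fractions: comparing multiplicities in
  \<open>a * d = c * b\<close> shows that any representation gives the same difference.\<close>

lemma rat_valuation_Fract:
  assumes p: "prime p" and ab: "a \<noteq> 0" "b \<noteq> 0"
  shows "rat_valuation p (Fract a b) = int (multiplicity (int p) a) - int (multiplicity (int p) b)"
proof -
  obtain c d where q: "quotient_of (Fract a b) = (c, d)" by fastforce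
  have d: "d > 0" using quotient_of_denom_pos q by blast
  have "Fract a b = Fract c d"
    using quotient_of_div[OF q] by (simp add: Fract_of_int_quotient)
  then have e: "a * d = c * b" using ab d by (simp add: eq_rat)
  then have c: "c \<noteq> 0" using ab d by auto
  have P: "prime_elem (int p)" using p by simp
  have "multiplicity (int p) a + multiplicity (int p) d
      = multiplicity (int p) c + multiplicity (int p) b"
    using arg_cong[OF e, of "multiplicity (int p)"] ab c d
    by (simp add: prime_elem_multiplicity_mult_distrib[OF P])
  then show ?thesis by (simp add: rat_valuation_def q)
qed

lemma rat_cases_nonzero:
  fixes q :: rat
  assumes "q \<noteq> 0"
  obtains a b where "q = Fract a b" "a \<noteq> 0" "b \<noteq> 0"
proof (cases q)
  case (Fract a b)
  then show ?thesis using assms that by (cases "a = 0") (auto simp: rat_number_collapse)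
qed

lemma rat_valuation_mult:
  assumes "prime p" "q \<noteq> 0" "r \<noteq> 0"
  shows "rat_valuation p (q * r) = rat_valuation p q + rat_valuation p r"
proof -
  obtain a b c d where "q = Fract a b" "a \<noteq> 0" "b \<noteq> 0" "r = Fract c d" "c \<noteq> 0" "d \<noteq> 0"
    using assms rat_cases_nonzero by metis
  moreover have "prime_elem (int p)" using assms by simp
  ultimately show ?thesis using assms
    by (simp add: rat_valuation_Fract prime_elem_multiplicity_mult_distrib)
qed

lemma rat_valuation_add:
  assumes p: "prime p" and nz: "q \<noteq> 0" "r \<noteq> 0" "q + r \<noteq> 0"
    and v: "m \<le> rat_valuation p q" "m \<le> rat_valuation p r"
  shows "m \<le> rat_valuation p (q + r)"
proof -
  obtain a b c d where q: "q = Fract a b" "a \<noteq> 0" "b \<noteq> 0" and r: "r = Fract c d" "c \<noteq> 0" "d \<noteq> 0"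
    using nz rat_cases_nonzero by metis
  let ?v = "multiplicity (int p)"
  have P: "prime_elem (int p)" using p by simp
  have qr: "q + r = Fract (a * d + c * b) (b * d)" using q r by simp
  then have s: "a * d + c * b \<noteq> 0" using nz by (auto simp: rat_number_collapse)
  have dist: "?v (x * y) = ?v x + ?v y" if "x \<noteq> 0" "y \<noteq> 0" for x y
    using that by (simp add: prime_elem_multiplicity_mult_distrib[OF P])
  \<comment> \<open>Over the common denominator \<open>b * d\<close> the numerators are
    \<open>a * d\<close> and \<open>c * b\<close>; the power with exponent \<open>e\<close> divides
    both, hence their sum.\<close>
  define e where "e = min (?v (a * d)) (?v (c * b))"
  have "int p ^ e dvd a * d" "int p ^ e dvd c * b"
    by (auto simp: e_def intro: multiplicity_dvd')
  then have "int p ^ e dvd a * d + c * b" by (rule dvd_add)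
  then have "e \<le> ?v (a * d + c * b)"
    using s P by (intro multiplicity_geI) (auto simp: prime_elem_def)
  moreover have "rat_valuation p (q + r) = int (?v (a * d + c * b)) - int (?v b + ?v d)"
    unfolding qr using q r s p by (simp add: rat_valuation_Fract dist)
  moreover have "m \<le> int (?v a) - int (?v b)" "m \<le> int (?v c) - int (?v d)"
    using v q r p by (simp_all add: rat_valuation_Fract)
  ultimately show ?thesis using q r by (auto simp: e_def dist min_def split: if_splits)
qed

text \<open>In lowest terms a prime dividing the denominator does not divide the numerator, so
  nothing can cancel the negative contribution.\<close>

lemma rat_valuation_nonneg_iff:
  assumes p: "prime p" and q: "q \<noteq> 0"
  shows "0 \<le> rat_valuation p q \<longleftrightarrow> \<not> int p dvd snd (quotient_of q)"
proof -
  obtain a b where ab: "quotient_of q = (a, b)" by fastforce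
  have cop: "coprime a b" using quotient_of_coprime[OF ab] .
  have b: "b \<noteq> 0" using quotient_of_denom_pos[OF ab] by simp
  show ?thesis
  proof (cases "int p dvd b")
    case True
    have "\<not> int p dvd a"
    proof
      assume "int p dvd a"
      then have "is_unit (int p)" using True by (rule coprime_common_divisor[OF cop])
      then show False using p by simp
    qed
    moreover have "multiplicity (int p) b > 0"
      using True b p by (intro iffD2[OF prime_multiplicity_gt_zero_iff]) auto
    ultimately show ?thesis using True by (simp add: rat_valuation_def ab not_dvd_imp_multiplicity_0)
  qed (simp add: rat_valuation_def ab not_dvd_imp_multiplicity_0)
qed

section \<open>Rational sections of a divisor on Spec Z\<close>

lemma O_div_zero: "0 \<in> O_div n V" by (simp add: O_div_def)

lemma O_div_iff:
  "q \<noteq> 0 \<Longrightarrow> q \<in> O_div n V \<longleftrightarrow> (\<forall>p. prime p \<longrightarrow> Prime_pt p \<in> V \<longrightarrow> - n p \<le> rat_valuation p q)"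
  by (simp add: O_div_def) (metis diff_ge_0_iff_ge diff_minus_eq_add)

lemma O_div_add:
  assumes "q \<in> O_div n V" "r \<in> O_div n V"
  shows "q + r \<in> O_div n V"
\<comment> \<open>\<open>rat_valuation\<close> takes an integer value at 0 instead of infinity, so
  zero summands and a zero sum are split off.\<close>
proof (cases "q = 0 \<or> r = 0 \<or> q + r = 0")
  case True
  then show ?thesis using assms O_div_zero by (elim disjE) simp_all
next
  case False
  then show ?thesis using assms rat_valuation_add[of _ q r] by (simp add: O_div_iff)
qed

lemma O_div_sum: "(\<And>x. x \<in> S \<Longrightarrow> h x \<in> O_div n V) \<Longrightarrow> sum h S \<in> O_div n V"
  by (induction S rule: infinite_finite_induct) (simp_all add: O_div_add O_div_zero)

text \<open>Stated for two divisors so that \<open>m = 0\<close> yields the module structure and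
  \<open>m = n = 0\<close> the ring structure.\<close>

lemma O_div_mult:
  assumes "q \<in> O_div m V" "r \<in> O_div n V"
  shows "q * r \<in> O_div (\<lambda>p. m p + n p) V"
proof (cases "q = 0 \<or> r = 0")
  case True
  then show ?thesis using O_div_zero by (elim disjE) simp_all
next
  case False
  have "- (m p + n p) \<le> rat_valuation p (q * r)" if "prime p" "Prime_pt p \<in> V" for p
  proof -
    have "- m p \<le> rat_valuation p q" "- n p \<le> rat_valuation p r"
      using assms False that by (simp_all add: O_div_iff)
    then show ?thesis using False that by (simp add: rat_valuation_mult)
  qed
  then show ?thesis using False by (simp add: O_div_iff)
qed

lemma Prime_pt_in_specZ [simp]: "Prime_pt p \<in> specZ \<longleftrightarrow> prime p"
  by (auto simp: specZ_def)

text \<open>Translates the description by denominators into one by valuations, so that closure is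
  proved once for \<open>O_div\<close>.\<close>

lemma O_specZ_eq_O_div: "O_specZ V = O_div (\<lambda>_. 0) V"
proof -
  have "q \<in> O_specZ V \<longleftrightarrow> q \<in> O_div (\<lambda>_. 0) V" for q
  proof (cases "q = 0")
    case True
    have "\<not> int p dvd 1" if "prime p" for p using that prime_gt_1_nat[OF that] by simp
    then show ?thesis unfolding True by (simp add: O_specZ_def O_div_zero)
  next
    case False
    have "q \<in> O_specZ V \<longleftrightarrow>
        (\<forall>p. prime p \<longrightarrow> Prime_pt p \<in> V \<longrightarrow> \<not> int p dvd snd (quotient_of q))"
      unfolding O_specZ_def mem_Collect_eq Diff_iff Prime_pt_in_specZ by blast
    also have "\<dots> \<longleftrightarrow> q \<in> O_div (\<lambda>_. 0) V"
      unfolding O_div_iff[OF False] using rat_valuation_nonneg_iff[OF _ False] by simp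
    finally show ?thesis .
  qed
  then show ?thesis by blast
qed

lemma O_div_Int_specZ: "O_div n (V \<inter> specZ) = O_div n V"
  unfolding O_div_def Int_iff Prime_pt_in_specZ by blast

lemma O_div_one: "1 \<in> O_div (\<lambda>_. 0) V" by (simp add: O_div_def rat_valuation_def)

section \<open>The sheaves\<close>

text \<open>One description for both sheaves: \<open>n = 0\<close>, \<open>c = 1\<close> gives the
  structure sheaf, and the coefficients of \<open>D\<close> with \<open>c = exp a\<close> give the
  divisor sheaf. Closure and gluing are then proved only once.\<close>

definition arith_sections :: "(nat \<Rightarrow> int) \<Rightarrow> real \<Rightarrow> arith_point set \<Rightarrow> nat \<Rightarrow> (nat \<Rightarrow> rat) set" where
  "arith_sections n c U k = (if U = {} then {\<lambda>x. 0}
     else {\<phi> \<in> gob (H_gamma (O_div n U)) k. Infinity_pt \<in> U \<longrightarrow> l1_norm k \<phi> \<le> c})"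

lemma generic_in_open: "openin specZ_bar_top U \<Longrightarrow> U \<noteq> {} \<Longrightarrow> Generic_pt \<in> U"
  by (auto simp: openin_specZ_bar_top specZ_bar_def specZ_def)

text \<open>Through the generic point. It ensures that for non-empty \<open>U\<close> the norm ball
  is never taken in the one-point value at the empty set.\<close>

lemma open_Int_specZ: "openin specZ_bar_top U \<Longrightarrow> U \<noteq> {} \<Longrightarrow> U \<inter> specZ \<noteq> {}"
  using generic_in_open[of U] by (auto simp: specZ_def)

lemma gob_O_specZ_bar:
  assumes "openin specZ_bar_top U"
  shows "gob (O_specZ_bar U) k = arith_sections (\<lambda>_. 0) 1 U k"
  using open_Int_specZ[OF assms]
  by (auto simp: O_specZ_bar_def H_O_specZ_def arith_sections_def norm_ball_def l1_norm_def
      point_alg_def O_specZ_eq_O_div O_div_Int_specZ)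

lemma gob_O_arakelov:
  assumes "openin specZ_bar_top U"
  shows "gob (O_arakelov D U) k = arith_sections (fin_part D) (exp (inf_coeff D)) U k"
  using open_Int_specZ[OF assms]
  by (auto simp: O_arakelov_def H_O_div_def arith_sections_def norm_ball_def l1_norm_def
      point_mod_def O_div_Int_specZ)

lemma O_specZ_bar_empty: "O_specZ_bar {} = point_alg"
  by (simp add: O_specZ_bar_def H_O_specZ_def)

lemma O_arakelov_empty: "O_arakelov D {} = point_mod"
  by (simp add: O_arakelov_def H_O_div_def)

lemma gmap_H_gamma_UNIV: "gmap (H_gamma E) = gmap (H_gamma UNIV)"
  and gbase_H_gamma_UNIV: "gbase (H_gamma E) = gbase (H_gamma UNIV)"
  by (simp_all add: H_gamma_def)

lemma O_specZ_bar_ops: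
  assumes "openin specZ_bar_top U" "U \<noteq> {}"
  shows "gbase (O_specZ_bar U) = gbase (H_gamma UNIV)" "gmap (O_specZ_bar U) = gmap (H_gamma UNIV)"
    "sunit (O_specZ_bar U) = H_unit" "smult (O_specZ_bar U) = H_mult"
  using open_Int_specZ[OF assms] assms(2) gmap_H_gamma_UNIV gbase_H_gamma_UNIV
  by (auto simp: O_specZ_bar_def H_O_specZ_def norm_ball_def)

lemma O_arakelov_ops:
  assumes "openin specZ_bar_top U" "U \<noteq> {}"
  shows "gbase (O_arakelov D U) = gbase (H_gamma UNIV)" "gmap (O_arakelov D U) = gmap (H_gamma UNIV)"
    "sact (O_arakelov D U) = H_mult"
  using open_Int_specZ[OF assms] assms(2) gmap_H_gamma_UNIV gbase_H_gamma_UNIV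
  by (auto simp: O_arakelov_def H_O_div_def norm_ball_def)

lemma arith_sections_subset: "U \<noteq> {} \<Longrightarrow> arith_sections n c U k \<subseteq> gob (H_gamma UNIV) k"
  by (auto simp: arith_sections_def gob_H_gamma)

lemma zero_in_arith_sections: "0 \<le> c \<Longrightarrow> (\<lambda>x. 0) \<in> arith_sections n c U k"
  by (simp add: arith_sections_def gob_H_gamma O_div_zero l1_norm_def)

lemma gmap_in_arith_sections:
  assumes "U \<noteq> {}" "f \<in> pointed_maps k l" "\<phi> \<in> arith_sections n c U k"
  shows "gmap (H_gamma E) k l f \<phi> \<in> arith_sections n c U l"
proof -
  have "gmap (H_gamma E) k l f \<phi> y \<in> O_div n U" if "y \<in> {1..l}" for y
    unfolding gmap_H[OF assms(2) that] using assms
    by (intro O_div_sum) (auto simp: arith_sections_def gob_H_gamma O_div_zero)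
  then show ?thesis using assms(1,3) order_trans[OF l1_norm_gmap[OF assms(2)]]
    by (auto simp: arith_sections_def gob_H_gamma gmap_H_outside)
qed

lemma H_unit_in_arith_sections: "U \<noteq> {} \<Longrightarrow> H_unit k i \<in> arith_sections (\<lambda>_. 0) 1 U k"
  by (simp add: arith_sections_def gob_H_gamma l1_norm_H_unit)
    (auto simp: H_unit_def O_div_zero O_div_one)

text \<open>Serves both as closure under multiplication (\<open>n = 0\<close>, \<open>c = 1\<close>)
  and as closure under the action.\<close>

lemma H_mult_in_arith_sections:
  assumes "U \<noteq> {}" "\<phi> \<in> arith_sections (\<lambda>_. 0) 1 U k" "\<psi> \<in> arith_sections n c U l"
  shows "H_mult k l \<phi> \<psi> \<in> arith_sections n c U (k * l)"
proof -
  have "H_mult k l \<phi> \<psi> x \<in> O_div n U" if "x \<in> {1..k * l}" for x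
    using assms that O_div_mult[of _ "\<lambda>_. 0" U _ n]
    by (intro H_mult_mem[of _ _ _ _ "O_div (\<lambda>_. 0) U" _ "O_div n U"])
      (auto simp: arith_sections_def gob_H_gamma)
  moreover have "l1_norm (k * l) (H_mult k l \<phi> \<psi>) \<le> c" if "Infinity_pt \<in> U"
  proof -
    have "l1_norm k \<phi> * l1_norm l \<psi> \<le> 1 * c"
      using assms that by (intro mult_mono) (auto simp: arith_sections_def l1_norm_nonneg)
    then show ?thesis by (simp add: l1_norm_H_mult)
  qed
  ultimately show ?thesis
    using assms(1) by (auto simp: arith_sections_def gob_H_gamma H_mult_outside)
qed

section \<open>Restriction and gluing of sections\<close>

lemma arith_sections_mono:
  assumes "V \<noteq> {}" "V \<subseteq> U"
  shows "arith_sections n c U k \<subseteq> arith_sections n c V k"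
proof -
  have "O_div n U \<subseteq> O_div n V" using assms by (auto simp: O_div_def)
  then show ?thesis using assms by (auto simp: arith_sections_def gob_H_gamma)
qed

text \<open>Each condition belongs to one point, a prime or infinity, and any point of the union
  lies in some member, which already imposes the condition. Empty members are left out because they
  would force the section to be 0.\<close>

lemma arith_sections_Union:
  assumes "\<And>V. V \<in> \<U> \<Longrightarrow> V \<noteq> {} \<Longrightarrow> \<phi> \<in> arith_sections n c V k" "\<Union>\<U> \<noteq> {}"
  shows "\<phi> \<in> arith_sections n c (\<Union>\<U>) k"
proof -
  obtain V where "V \<in> \<U>" "V \<noteq> {}" using assms(2) by auto
  then have out: "\<forall>x. x \<notin> {1..k} \<longrightarrow> \<phi> x = 0"
    using assms(1) by (force simp: arith_sections_def gob_H_gamma)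
  have local: "(\<forall>x\<in>{1..k}. \<phi> x \<in> O_div n V) \<and> (Infinity_pt \<in> V \<longrightarrow> l1_norm k \<phi> \<le> c)"
    if "V \<in> \<U>" "V \<noteq> {}" for V
    using assms(1)[OF that] that by (auto simp: arith_sections_def gob_H_gamma)
  have "\<phi> x \<in> O_div n (\<Union>\<U>)" if "x \<in> {1..k}" for x
  proof (cases "\<phi> x = 0")
    case False
    have "- n p \<le> rat_valuation p (\<phi> x)" if p: "prime p" "Prime_pt p \<in> \<Union>\<U>" for p
    proof -
      from p(2) obtain W where W: "W \<in> \<U>" "Prime_pt p \<in> W" by blast
      then have "\<phi> x \<in> O_div n W" using local[of W] \<open>x \<in> {1..k}\<close> by blast
      then show ?thesis using W(2) p(1) False by (simp add: O_div_iff)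
    qed
    then show ?thesis using False by (simp add: O_div_iff)
  qed (simp add: O_div_zero)
  moreover have "Infinity_pt \<in> \<Union>\<U> \<longrightarrow> l1_norm k \<phi> \<le> c" using local by blast
  ultimately show ?thesis using assms(2) out by (auto simp: arith_sections_def gob_H_gamma)
qed

lemma sheaf_of_sets_arith_sections:
  assumes "0 \<le> c"
  shows "sheaf_of_sets specZ_bar_top (\<lambda>U. arith_sections n c U k) (\<lambda>U V. arith_res U V k)"
proof
  fix U V s
  assume "V \<subseteq> U" "s \<in> arith_sections n c U k"
  then show "arith_res U V k s \<in> arith_sections n c V k"
    using arith_sections_mono[of V U n c k] zero_in_arith_sections[OF assms, of n V k]
    by (cases "V = {}") (auto simp: arith_res_def)
next
  fix U s
  assume "s \<in> arith_sections n c U k"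
  then show "arith_res U U k s = s" by (auto simp: arith_res_def arith_sections_def)
next
  fix U V W :: "arith_point set" and s
  assume "W \<subseteq> V"
  then show "arith_res V W k (arith_res U V k s) = arith_res U W k s"
    by (auto simp: arith_res_def)
next
  fix \<U> and \<sigma> :: "arith_point set \<Rightarrow> nat \<Rightarrow> rat"
  assume op: "\<And>V. V \<in> \<U> \<Longrightarrow> openin specZ_bar_top V"
    and \<sigma>: "\<And>V. V \<in> \<U> \<Longrightarrow> \<sigma> V \<in> arith_sections n c V k"
    and comp: "\<And>V W. V \<in> \<U> \<Longrightarrow> W \<in> \<U> \<Longrightarrow>
      arith_res V (V \<inter> W) k (\<sigma> V) = arith_res W (V \<inter> W) k (\<sigma> W)"
  have \<sigma>0: "\<sigma> {} = (\<lambda>x. 0)" if "{} \<in> \<U>" using \<sigma>[OF that] by (simp add: arith_sections_def)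
  show "\<exists>!t. t \<in> arith_sections n c (\<Union>\<U>) k \<and> (\<forall>V\<in>\<U>. arith_res (\<Union>\<U>) V k t = \<sigma> V)"
  proof (cases "\<Union>\<U> = {}")
    \<comment> \<open>This includes the empty cover: the value over the empty set is one point, and
      the zero section is the unique gluing.\<close>
    case True
    then have "\<forall>V\<in>\<U>. V = {}" by auto
    then have "\<sigma> V = (\<lambda>x. 0)" if "V \<in> \<U>" for V using \<sigma>0 that by metis
    then show ?thesis using True \<open>\<forall>V\<in>\<U>. V = {}\<close> by (auto simp: arith_sections_def arith_res_def)
  next
    case False
    then obtain V where V: "V \<in> \<U>" "V \<noteq> {}" by auto
    have eq: "\<sigma> W = \<sigma> V" if W: "W \<in> \<U>" "W \<noteq> {}" for W
    proof -
      \<comment> \<open>The generic point lies in both, so restriction to the intersection is the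
        identity and compatibility becomes equality.\<close>
      have "V \<inter> W \<noteq> {}" using generic_in_open[OF op] V W by blast
      then show ?thesis using comp[OF V(1) W(1)] by (simp add: arith_res_def)
    qed
    show ?thesis
    proof (rule ex1I[of _ "\<sigma> V"], intro conjI ballI)
      show "\<sigma> V \<in> arith_sections n c (\<Union>\<U>) k"
        using arith_sections_Union[OF _ False] \<sigma> eq by metis
      fix W assume "W \<in> \<U>"
      then show "arith_res (\<Union>\<U>) W k (\<sigma> V) = \<sigma> W"
        using \<sigma>0 eq by (cases "W = {}") (auto simp: arith_res_def)
    next
      fix t assume "t \<in> arith_sections n c (\<Union>\<U>) k \<and> (\<forall>V\<in>\<U>. arith_res (\<Union>\<U>) V k t = \<sigma> V)"
      then have "arith_res (\<Union>\<U>) V k t = \<sigma> V" using V(1) by blast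
      then show "t = \<sigma> V" using V(2) by (simp add: arith_res_def)
    qed
  qed
qed

text \<open>Agreement on open sets suffices, as the union of a cover is open; the descriptions by
  \<open>arith_sections\<close> are available exactly there.\<close>

lemma sheaf_of_sets_cong:
  assumes "sheaf_of_sets X F r" "\<And>U. openin X U \<Longrightarrow> G U = F U"
  shows "sheaf_of_sets X G r"
proof -
  interpret sheaf_of_sets X F r by fact
  show ?thesis
  proof
    fix \<U> \<sigma>
    assume *: "\<And>V. V \<in> \<U> \<Longrightarrow> openin X V" "\<And>V. V \<in> \<U> \<Longrightarrow> \<sigma> V \<in> G V"
      "\<And>V W. V \<in> \<U> \<Longrightarrow> W \<in> \<U> \<Longrightarrow> r V (V \<inter> W) (\<sigma> V) = r W (V \<inter> W) (\<sigma> W)"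
    have "\<exists>!t. t \<in> F (\<Union>\<U>) \<and> (\<forall>V\<in>\<U>. r (\<Union>\<U>) V t = \<sigma> V)"
      by (rule glue) (use * assms(2) in auto)
    moreover have "G (\<Union>\<U>) = F (\<Union>\<U>)" using *(1) by (intro assms(2) openin_Union)
    ultimately show "\<exists>!t. t \<in> G (\<Union>\<U>) \<and> (\<forall>V\<in>\<U>. r (\<Union>\<U>) V t = \<sigma> V)" by simp
  qed (use assms(2) res_closed res_id res_comp in auto)
qed

section \<open>Algebra and module structures with their restrictions\<close>

lemma s_algebra_O_specZ_bar:
  assumes U: "openin specZ_bar_top U"
  shows "s_algebra (O_specZ_bar U)"
proof (cases "U = {}")
  case True
  show ?thesis unfolding True O_specZ_bar_empty
    by unfold_locales (auto simp: point_alg_def gamma_morphism_def day_morphism_def sphere_def)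
next
  case False
  \<comment> \<open>Brings the base point into the form in which
    \<open>zero_in_arith_sections\<close> applies.\<close>
  have "gbase (H_gamma UNIV) k = (\<lambda>x. 0 :: rat)" for k by (simp add: H_gamma_def)
  then show ?thesis
    by (intro s_subalgebra[OF s_algebra_H])
      (use False arith_sections_subset in
        \<open>auto simp: O_specZ_bar_ops[OF U False] gob_O_specZ_bar[OF U] zero_in_arith_sections
          gmap_in_arith_sections H_unit_in_arith_sections H_mult_in_arith_sections\<close>)
qed

lemma s_module_O_arakelov:
  assumes U: "openin specZ_bar_top U"
  shows "s_module (O_specZ_bar U) (O_arakelov D U)"
proof (cases "U = {}")
  case True
  interpret s_algebra point_alg
    using s_algebra_O_specZ_bar[OF U] unfolding True O_specZ_bar_empty .
  show ?thesis unfolding True O_specZ_bar_empty O_arakelov_empty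
    by unfold_locales (auto simp: point_mod_def day_morphism_def)
next
  case False
  have "gbase (H_gamma UNIV) k = (\<lambda>x. 0 :: rat)" for k by (simp add: H_gamma_def)
  then show ?thesis
    by (intro s_submodule[OF s_module_H s_algebra_O_specZ_bar[OF U]])
      (use False arith_sections_subset in
        \<open>auto simp: O_specZ_bar_ops[OF U False] O_arakelov_ops[OF U False] gob_O_specZ_bar[OF U]
          gob_O_arakelov[OF U] zero_in_arith_sections gmap_in_arith_sections
          H_mult_in_arith_sections\<close>)
qed

text \<open>The inclusion claimed in the first part. The empty set is excluded because the zero unit
  of \<open>point_alg\<close> is not the unit of the rational algebra.\<close>

lemma s_algebra_morphism_to_HQ:
  assumes U: "openin specZ_bar_top U" "U \<noteq> {}"
  shows "s_algebra_morphism (O_specZ_bar U) (H_alg (UNIV :: rat set)) (\<lambda>k \<phi>. \<phi>)"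
  using subsetD[OF arith_sections_subset[OF U(2)]]
  by (auto simp: s_algebra_morphism_def gamma_morphism_def O_specZ_bar_ops[OF U]
      gob_O_specZ_bar[OF U(1)])

text \<open>For non-empty \<open>V\<close> the restriction is the identity on functions and both
  sides carry the same operations; for empty \<open>V\<close> the target operations are constantly
  zero.\<close>

lemma s_algebra_morphism_arith_res:
  assumes U: "openin specZ_bar_top U" and V: "openin specZ_bar_top V" and "V \<subseteq> U"
  shows "s_algebra_morphism (O_specZ_bar U) (O_specZ_bar V) (arith_res U V)"
proof (cases "V = {}")
  case True
  show ?thesis unfolding True O_specZ_bar_empty
    by (auto simp: s_algebra_morphism_def gamma_morphism_def point_alg_def arith_res_def)
next
  case False
  then have "U \<noteq> {}" using assms by auto
  then show ?thesis using arith_sections_mono[OF False \<open>V \<subseteq> U\<close>] False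
    by (auto simp: s_algebra_morphism_def gamma_morphism_def arith_res_def
        O_specZ_bar_ops[OF U] O_specZ_bar_ops[OF V] gob_O_specZ_bar[OF U] gob_O_specZ_bar[OF V])
qed

lemma gamma_morphism_arith_res:
  assumes U: "openin specZ_bar_top U" and V: "openin specZ_bar_top V" and "V \<subseteq> U"
  shows "gamma_morphism (O_arakelov D U) (O_arakelov D V) (arith_res U V)"
proof (cases "V = {}")
  case True
  show ?thesis unfolding True O_arakelov_empty
    by (auto simp: gamma_morphism_def point_mod_def arith_res_def)
next
  case False
  then have "U \<noteq> {}" using assms by auto
  then show ?thesis using arith_sections_mono[OF False \<open>V \<subseteq> U\<close>] False
    by (auto simp: gamma_morphism_def arith_res_def O_arakelov_ops[OF U] O_arakelov_ops[OF V]
        gob_O_arakelov[OF U] gob_O_arakelov[OF V])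
qed

lemma arith_res_act:
  assumes U: "openin specZ_bar_top U" and V: "openin specZ_bar_top V" and "V \<subseteq> U"
  shows "arith_res U V (k * l) (sact (O_arakelov D U) k l x m)
    = sact (O_arakelov D V) k l (arith_res U V k x) (arith_res U V l m)"
proof (cases "V = {}")
  case True
  show ?thesis unfolding True O_arakelov_empty by (simp add: point_mod_def arith_res_def)
next
  case False
  then have "U \<noteq> {}" using assms by auto
  with False show ?thesis by (simp add: arith_res_def O_arakelov_ops[OF U] O_arakelov_ops[OF V])
qed

lemma sheaf_O_specZ_bar: "sheaf_of_s_algebras specZ_bar_top O_specZ_bar arith_res"
proof (rule sheaf_of_s_algebras.intro)
  show "sheaf_of_sets specZ_bar_top (\<lambda>U. gob (O_specZ_bar U) k) (\<lambda>U V. arith_res U V k)" for k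
    by (rule sheaf_of_sets_cong[OF sheaf_of_sets_arith_sections[of 1 "\<lambda>_. 0"]])
      (simp_all add: gob_O_specZ_bar)
qed (simp_all add: s_algebra_O_specZ_bar s_algebra_morphism_arith_res)

lemma sheaf_O_arakelov:
  "sheaf_of_s_modules specZ_bar_top O_specZ_bar arith_res (O_arakelov D) arith_res"
proof (intro sheaf_of_s_modules.intro[OF sheaf_O_specZ_bar] sheaf_of_s_modules_axioms.intro)
  show "sheaf_of_sets specZ_bar_top (\<lambda>U. gob (O_arakelov D U) k) (\<lambda>U V. arith_res U V k)" for k
    by (rule sheaf_of_sets_cong[OF
          sheaf_of_sets_arith_sections[of "exp (inf_coeff D)" "fin_part D"]])
      (simp_all add: gob_O_arakelov)
qed (simp_all add: s_module_O_arakelov gamma_morphism_arith_res arith_res_act)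

theorem proposition6p3:
  shows "sheaf_of_s_algebras specZ_bar_top O_specZ_bar arith_res \<and>
     (\<forall>U. openin specZ_bar_top U \<and> U \<noteq> {} \<longrightarrow>
        s_algebra_morphism (O_specZ_bar U) (H_alg (UNIV :: rat set)) (\<lambda>k \<phi>. \<phi>)) \<and>
     (\<forall>D. is_arakelov_divisor D \<longrightarrow>
        sheaf_of_s_modules specZ_bar_top O_specZ_bar arith_res (O_arakelov D) arith_res \<and>
        (\<forall>U. openin specZ_top U \<longrightarrow> O_arakelov D U = H_O_div (fin_part D) U))"
  \<comment> \<open>An open set of Spec Z omits \<open>Infinity_pt\<close>, so the extension clause
    is the second branch of \<open>O_arakelov\<close>.\<close>
  using sheaf_O_specZ_bar s_algebra_morphism_to_HQ sheaf_O_arakelov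
  by (auto simp: openin_specZ_top O_arakelov_def)

end
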